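(* There exists a non-constant analytic map $\phi\colon\mathbb D\to\mathbb D$ for which the composition operator $C_\phi f=f\circ\phi$ is compact on the Hardy space $H^2$, but is not in any Schatten class $S_p(\mathfrak B^2)$ of the Bergman space $\mathfrak B^2$ with $0<p<\infty$.
   Context: $\mathbb D$ is the open unit disk of $\mathbb C$. $H^2$ is the space of analytic $f(z)=\sum_{k\ge0} c_kz^k$ on $\mathbb D$ with $\|f\|_{H^2}^2=\sum_k|c_k|^2<\infty$; $\mathfrak B^2$ is the space of analytic $f$ on $\mathbb D$ with $\|f\|_{\mathfrak B^2}^2=\int_{\mathbb D}|f|^2\,dA<\infty$, where $dA=dx\,dy/\pi$. For a Hilbert space $H$ and $p>0$, $S_p(H)$ is the set of compact operators $T$ on $H$ with $\sum_{n\ge1}a_n(T)^p<\infty$, where $a_n(T)=\inf\{\|T-R\|:\operatorname{rank}R<n\}$ are the approximation (equivalently singular) numbers. *)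

theory Defs
  imports
    "HOL-Complex_Analysis.Complex_Analysis"
    "HOL-Library.Function_Algebras"
begin

definition cfun_scale :: "complex \<Rightarrow> (complex \<Rightarrow> complex) \<Rightarrow> complex \<Rightarrow> complex" where
  "cfun_scale c f = (\<lambda>z. c * f z)"

interpretation cfun: vector_space cfun_scale
  by unfold_locales (auto simp: cfun_scale_def fun_eq_iff algebra_simps)

text \<open>
  A function on the open unit disk is represented by its extension by 0 to the whole plane, so that
  equality of functions on the disk is equality in HOL. A normed space of such functions is given by
  its carrier \<open>V\<close> and its norm \<open>N\<close>, and an operator on it by a map that matters only on \<open>V\<close>.
\<close>

definition disc_holo :: "(complex \<Rightarrow> complex) set" where
  "disc_holo = {f. f holomorphic_on ball 0 1 \<and> (\<forall>z. z \<notin> ball 0 1 \<longrightarrow> f z = 0)}"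

definition hardy :: "(complex \<Rightarrow> complex) set" where
  "hardy = {f \<in> disc_holo. summable (\<lambda>k. (cmod (fps_nth (fps_expansion f 0) k))\<^sup>2)}"

definition hardy_norm :: "(complex \<Rightarrow> complex) \<Rightarrow> real" where
  "hardy_norm f = sqrt (\<Sum>k. (cmod (fps_nth (fps_expansion f 0) k))\<^sup>2)"

definition bergman :: "(complex \<Rightarrow> complex) set" where
  "bergman = {f \<in> disc_holo. set_integrable lborel (ball 0 1) (\<lambda>z. (cmod (f z))\<^sup>2)}"

definition bergman_norm :: "(complex \<Rightarrow> complex) \<Rightarrow> real" where
  "bergman_norm f = sqrt ((LINT z:ball 0 1|lborel. (cmod (f z))\<^sup>2) / pi)"

definition comp_op :: "(complex \<Rightarrow> complex) \<Rightarrow> (complex \<Rightarrow> complex) \<Rightarrow> complex \<Rightarrow> complex" where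
  "comp_op \<phi> f = (\<lambda>z. if z \<in> ball 0 1 then f (\<phi> z) else 0)"

definition bounded_op ::
  "(complex \<Rightarrow> complex) set \<Rightarrow> ((complex \<Rightarrow> complex) \<Rightarrow> real) \<Rightarrow>
    ((complex \<Rightarrow> complex) \<Rightarrow> complex \<Rightarrow> complex) \<Rightarrow> bool" where
  "bounded_op V N T \<longleftrightarrow>
     (\<forall>f\<in>V. T f \<in> V) \<and>
     (\<forall>f\<in>V. \<forall>g\<in>V. T (f + g) = T f + T g) \<and>
     (\<forall>c. \<forall>f\<in>V. T (cfun_scale c f) = cfun_scale c (T f)) \<and>
     (\<exists>K. \<forall>f\<in>V. N (T f) \<le> K * N f)"

definition compact_op ::
  "(complex \<Rightarrow> complex) set \<Rightarrow> ((complex \<Rightarrow> complex) \<Rightarrow> real) \<Rightarrow>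
    ((complex \<Rightarrow> complex) \<Rightarrow> complex \<Rightarrow> complex) \<Rightarrow> bool" where
  "compact_op V N T \<longleftrightarrow> bounded_op V N T \<and>
     (\<forall>F K. (\<forall>n::nat. F n \<in> V \<and> N (F n) \<le> K) \<longrightarrow>
        (\<exists>g\<in>V. \<exists>r. strict_mono r \<and> (\<lambda>n. N (T (F (r n)) - g)) \<longlonglongrightarrow> 0))"

text \<open>Only meaningful for bounded operators: on other arguments the supremum may be of an unbounded set.\<close>

definition op_norm ::
  "(complex \<Rightarrow> complex) set \<Rightarrow> ((complex \<Rightarrow> complex) \<Rightarrow> real) \<Rightarrow>
    ((complex \<Rightarrow> complex) \<Rightarrow> complex \<Rightarrow> complex) \<Rightarrow> real" where
  "op_norm V N T = (SUP f\<in>{f \<in> V. N f \<le> 1}. N (T f))"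

text \<open>
  The rank is not expressed by \<open>cfun.dim\<close>, which is 0 on infinite-dimensional spaces.
\<close>

definition rank_less ::
  "(complex \<Rightarrow> complex) set \<Rightarrow> ((complex \<Rightarrow> complex) \<Rightarrow> complex \<Rightarrow> complex) \<Rightarrow> nat \<Rightarrow> bool" where
  "rank_less V R n \<longleftrightarrow> (\<exists>B. finite B \<and> card B < n \<and> R ` V \<subseteq> cfun.span B)"

definition approx_num ::
  "(complex \<Rightarrow> complex) set \<Rightarrow> ((complex \<Rightarrow> complex) \<Rightarrow> real) \<Rightarrow>
    ((complex \<Rightarrow> complex) \<Rightarrow> complex \<Rightarrow> complex) \<Rightarrow> nat \<Rightarrow> real" where
  "approx_num V N T n = (INF R\<in>{R. bounded_op V N R \<and> rank_less V R n}. op_norm V N (T - R))"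

definition schatten ::
  "real \<Rightarrow> (complex \<Rightarrow> complex) set \<Rightarrow> ((complex \<Rightarrow> complex) \<Rightarrow> real) \<Rightarrow>
    ((complex \<Rightarrow> complex) \<Rightarrow> complex \<Rightarrow> complex) set" where
  "schatten p V N = {T. compact_op V N T \<and> summable (\<lambda>n. approx_num V N T (Suc n) powr p)}"

end

(*
  Let u_k = 1 / (1 + ln (1 + ln (1 + k))). This sequence is log-convex, so by Kaluza's theorem
  1 - 1 / (sum of u_k z^k) = phi(z) has coefficients p_k >= 0, and their sum is at most 1.

  On H^2 the matrix of C_phi has as its (k, n) entry the k-th coefficient of phi^n. It is
  nonnegative, its n-th column sums to at most 1 and its k-th row sums to the k-th coefficient of
  1 / (1 - phi), which is u_k. Since u_k tends to 0, the Schur test makes the tails of C_phi f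
  uniformly small, and C_phi is compact.

  On the Bergman space let s_j = 100^-(j+1) and let phi(1 - t_j) = 1 - s_j. The disc of radius t_j / 3
  about 1 - t_j is mapped into the disc of radius s_j / 3 about 1 - s_j. Kernel functions of unit
  size living at distance s_j from 1 are almost orthogonal, both before and after composition
  (there with the weight t_j / s_j), so the n-th approximation number is at least a constant times
  the minimum of t_j / s_j over j < n. By the choice of u_k this minimum decays no faster than 1 / ln n.
*)

theory Submission
  imports Defs "HOL-Real_Asymp.Real_Asymp"
begin

section \<open>Kaluza sequences\<close>

text \<open>Both halves are governed by the same sequence. If U(x) is the sum of u_k x^k, then 1 -
  \<phi>(1 - t) = 1 / U(1 - t), and U(1 - t) is at least a constant times u_k / t for k about 2 / t.
  So t_j / s_j is at least a constant times u_k with k about 2 / t_j. Compactness on H^2 asks only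
  that u_k tend to 0; the rate is free and is spent on the Bergman side. Almost orthogonality needs
  scales s_j that shrink geometrically, so n test functions reach indices k exponential in n. A
  single logarithm in u_k would give a bound of order 1 / n, whose p-th powers are summable for p >
  1. The second logarithm makes it 1 / ln n, which lies in no l^p. The ratio 100 of the scales is
  large so that the interference between different kernels, two geometric series of total at most 2
  / 99, stays well below the diagonal constant 27 / 343. Nonnegative coefficients with sum at most 1
  serve three times: for the Schur test, for the self-map property and for the termwise estimate of
  \<phi> on discs.\<close>

text \<open>Kaluza's theorem. The identity \<open>P * U = U - 1\<close> is a renewal equation in
  each positive degree. Multiplying the equation of degree \<open>Suc m\<close> by
  \<open>U m\<close>, that of degree \<open>m\<close> by \<open>U (Suc m)\<close>, and subtracting
  isolates \<open>U m * P (Suc m)\<close> as a combination of earlier coefficients of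
  \<open>P\<close>. Its weights are nonnegative because log-convexity makes the ratios of
  consecutive coefficients increase.\<close>

lemma kaluza_nonneg:
  fixes U :: "real fps"
  assumes U0: "fps_nth U 0 = 1" and pos: "\<And>n. fps_nth U n > 0"
    and convex: "\<And>n. (fps_nth U (Suc n))\<^sup>2 \<le> fps_nth U n * fps_nth U (Suc (Suc n))"
  shows "fps_nth (1 - inverse U) n \<ge> 0"
proof -
  define P where "P = 1 - inverse U"
  have P0: "fps_nth P 0 = 0"
    by (simp add: P_def U0)
  have "P * U = U - 1"
    using inverse_mult_eq_1[of U] U0 by (simp add: P_def algebra_simps)
  then have rec: "(\<Sum>k=1..n. fps_nth P k * fps_nth U (n - k)) = fps_nth U n" if "n > 0" for n
  proof -
    have "fps_nth (P * U) n = fps_nth U n"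
      using \<open>P * U = U - 1\<close> that by simp
    then show ?thesis
      by (simp add: fps_mult_nth sum.atLeast_Suc_atMost P0)
  qed
  have ratio: "fps_nth U (Suc m) * fps_nth U n \<le> fps_nth U (Suc n) * fps_nth U m" if "m \<le> n" for m n
    using that
  proof (induction n rule: dec_induct)
    case (step n)
    have "fps_nth U (Suc m) * fps_nth U (Suc n) * fps_nth U n
        \<le> fps_nth U (Suc n) * (fps_nth U (Suc n) * fps_nth U m)"
      using mult_left_mono[OF step.IH less_imp_le[OF pos[of "Suc n"]]] by (simp add: algebra_simps)
    also have "\<dots> = (fps_nth U (Suc n))\<^sup>2 * fps_nth U m"
      by (simp add: power2_eq_square)
    also have "\<dots> \<le> fps_nth U n * fps_nth U (Suc (Suc n)) * fps_nth U m"
      using convex pos by (intro mult_right_mono) (auto intro: less_imp_le)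
    finally have "fps_nth U (Suc m) * fps_nth U (Suc n) * fps_nth U n
        \<le> fps_nth U (Suc (Suc n)) * fps_nth U m * fps_nth U n"
      by (simp add: mult_ac)
    then show ?case
      using pos[of n] by (simp add: mult_le_cancel_right)
  qed simp
  have "fps_nth P n \<ge> 0"
  proof (induction n rule: less_induct)
    case (less n)
    show ?case
    proof (cases "n \<le> 1")
      case True
      then show ?thesis
        using P0 rec[of 1] U0 pos[of 1] by (cases n) auto
    next
      case False
      then obtain m where n: "n = Suc m" and m: "m > 0"
        by (metis One_nat_def Suc_le_mono not0_implies_Suc not_gr_zero zero_le)
      have "fps_nth U m * fps_nth P n = fps_nth U m * fps_nth U n
              - fps_nth U m * (\<Sum>k=1..m. fps_nth P k * fps_nth U (n - k))"
        unfolding n by (subst rec[of "Suc m", symmetric]) (simp_all add: U0 algebra_simps)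
      also have "fps_nth U m * fps_nth U n = fps_nth U n * (\<Sum>k=1..m. fps_nth P k * fps_nth U (m - k))"
        using rec[OF m] by simp
      also have "\<dots> - fps_nth U m * (\<Sum>k=1..m. fps_nth P k * fps_nth U (n - k)) =
          (\<Sum>k=1..m. fps_nth P k * (fps_nth U (Suc m) * fps_nth U (m - k) - fps_nth U (Suc (m - k)) * fps_nth U m))"
        unfolding n sum_distrib_left sum_subtractf[symmetric]
        by (intro sum.cong refl) (simp add: algebra_simps Suc_diff_le)
      also have "\<dots> \<ge> 0"
        using ratio less.IH n by (intro sum_nonneg mult_nonneg_nonneg) auto
      finally show ?thesis
        using pos[of m] by (simp add: zero_le_mult_iff)
    qed
  qed
  then show ?thesis by (simp add: P_def)
qed

text \<open>In the convolution that produces \<open>U n\<close>, every factor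
  \<open>U (n - k)\<close> is at least \<open>U n\<close>, since the sequence decreases. Replacing
  it by \<open>U n\<close> and cancelling gives the bound.\<close>

lemma renewal_sum_le_1:
  fixes U :: "real fps"
  assumes U0: "fps_nth U 0 = 1" and pos: "\<And>n. fps_nth U n > 0"
    and dec: "decseq (fps_nth U)" and nonneg: "\<And>n. fps_nth (1 - inverse U) n \<ge> 0"
  shows "(\<Sum>k\<le>n. fps_nth (1 - inverse U) k) \<le> 1"
proof (cases "n = 0")
  case False
  define P where "P = 1 - inverse U"
  have "P * U = U - 1"
    using inverse_mult_eq_1[of U] U0 by (simp add: P_def algebra_simps)
  then have "fps_nth (P * U) n = fps_nth U n"
    using False by simp
  then have rec: "(\<Sum>k\<le>n. fps_nth P k * fps_nth U (n - k)) = fps_nth U n"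
    by (simp add: fps_mult_nth atLeast0AtMost)
  have "fps_nth U n * (\<Sum>k\<le>n. fps_nth P k) \<le> (\<Sum>k\<le>n. fps_nth P k * fps_nth U (n - k))"
    unfolding sum_distrib_left
  proof (rule sum_mono)
    fix k
    show "fps_nth U n * fps_nth P k \<le> fps_nth P k * fps_nth U (n - k)"
      using mult_left_mono[OF decseqD[OF dec, of "n - k" n] nonneg[of k]] by (simp add: P_def mult.commute)
  qed
  also have "\<dots> = fps_nth U n"
    by (fact rec)
  finally show ?thesis
    using pos[of n] by (simp add: P_def)
qed (simp add: U0)

section \<open>The doubly logarithmic weight\<close>

text \<open>This is 1 / u_k with a real argument, because it is later evaluated at
  \<open>2 / t\<close>. The added ones keep both logarithms nonnegative and give the value 1 at 0,
  hence u_0 = 1.\<close>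

definition slow :: "real \<Rightarrow> real" where
  "slow y = 1 + ln (1 + ln (1 + y))"

lemma slow_mono: "0 \<le> x \<Longrightarrow> x \<le> y \<Longrightarrow> slow x \<le> slow y"
  by (auto simp: slow_def add_pos_nonneg)

lemma slow_ge_1: "0 \<le> y \<Longrightarrow> slow y \<ge> 1"
  by (auto simp: slow_def)

text \<open>Deliberately crude: it only has to bound \<open>t\<close> below by a power of 1 -
  \<phi>(1 - t). The logarithms in \<open>slow\<close> make the exponent of that power
  harmless.\<close>

lemma slow_le_sqrt:
  assumes "0 \<le> y" shows "slow y \<le> 2 * sqrt (1 + y)"
proof -
  have "slow y \<le> 1 + ln (1 + y)"
    using assms by (simp add: slow_def ln_add_one_self_le_self)
  also have "\<dots> = 1 + 2 * ln (sqrt (1 + y))"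
    using assms by (simp add: ln_sqrt)
  also have "\<dots> \<le> 1 + 2 * (sqrt (1 + y) - 1)"
    using assms ln_le_minus_one[of "sqrt (1+y)"] by simp
  finally show ?thesis by simp
qed

text \<open>The map \<open>1 + ln\<close> preserves log-concavity: the logarithm turns the product
  into a sum, and the inequality of arithmetic and geometric means turns the sum back into a
  product. Two applications carry the log-concavity of the sequence k + 1 through both logarithms of
  \<open>slow\<close>; reciprocals are then log-convex.\<close>

lemma one_plus_ln_mid:
  fixes a b c :: real
  assumes "1 \<le> a" "1 \<le> b" "1 \<le> c" "a * c \<le> b\<^sup>2"
  shows "(1 + ln a) * (1 + ln c) \<le> (1 + ln b)\<^sup>2"
proof -
  have "ln a + ln c = ln (a * c)"
    using assms by (simp add: ln_mult)
  also have "\<dots> \<le> ln (b\<^sup>2)"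
    using assms by (subst ln_le_cancel_iff) (auto intro!: mult_pos_pos)
  also have "\<dots> = 2 * ln b"
    using assms by (simp add: ln_realpow)
  finally have *: "(1 + ln a) + (1 + ln c) \<le> 2 * (1 + ln b)"
    by simp
  have "4 * ((1 + ln a) * (1 + ln c)) \<le> ((1 + ln a) + (1 + ln c))\<^sup>2"
    using zero_le_power2[of "ln a - ln c"] by (simp add: power2_eq_square algebra_simps)
  also have "\<dots> \<le> (2 * (1 + ln b))\<^sup>2"
    using * assms by (intro power_mono) auto
  also have "\<dots> = 4 * (1 + ln b)\<^sup>2"
    by (subst power_mult_distrib) simp
  finally show ?thesis
    by simp
qed

definition slow_fps :: "real fps" where "slow_fps = Abs_fps (\<lambda>k. 1 / slow (real k))"
definition symbol_fps :: "real fps" where "symbol_fps = 1 - inverse slow_fps"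

lemma slow_fps_0: "fps_nth slow_fps 0 = 1"
  by (simp add: slow_fps_def slow_def)

lemma slow_fps_pos: "fps_nth slow_fps n > 0"
  using slow_ge_1[of "real n"] by (simp add: slow_fps_def)

lemma slow_fps_decseq: "decseq (fps_nth slow_fps)"
  unfolding decseq_def slow_fps_def fps_nth_Abs_fps
proof (intro allI impI frac_le)
  fix m n :: nat assume "m \<le> n"
  then show "slow (real m) \<le> slow (real n)"
    by (intro slow_mono) auto
  show "slow (real m) > 0"
    using slow_ge_1[of "real m"] by simp
qed auto

lemma slow_fps_le_1: "fps_nth slow_fps n \<le> 1"
  using decseqD[OF slow_fps_decseq, of 0 n] slow_fps_0 by simp

lemma slow_fps_tendsto_0: "fps_nth slow_fps \<longlonglongrightarrow> 0"
  unfolding slow_fps_def slow_def fps_nth_Abs_fps by real_asymp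

lemma slow_fps_log_convex: "(fps_nth slow_fps (Suc n))\<^sup>2 \<le> fps_nth slow_fps n * fps_nth slow_fps (Suc (Suc n))"
proof -
  have "(1 + ln (1 + real n)) * (1 + ln (1 + real (Suc (Suc n)))) \<le> (1 + ln (1 + real (Suc n)))\<^sup>2"
    by (rule one_plus_ln_mid) (auto simp: power2_eq_square algebra_simps)
  then have *: "slow (real n) * slow (real (Suc (Suc n))) \<le> (slow (real (Suc n)))\<^sup>2"
    unfolding slow_def by (rule one_plus_ln_mid[rotated -1]) simp_all
  have "slow (real k) > 0" for k
    using slow_ge_1[of "real k"] by simp
  then show ?thesis
    using * by (simp add: slow_fps_def power_divide frac_le mult_pos_pos del: of_nat_Suc)
qed

lemma symbol_fps_nonneg: "fps_nth symbol_fps n \<ge> 0"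
  unfolding symbol_fps_def by (rule kaluza_nonneg[OF slow_fps_0 slow_fps_pos slow_fps_log_convex])

lemma symbol_fps_sum_le_1: "(\<Sum>k\<le>n. fps_nth symbol_fps k) \<le> 1"
  using symbol_fps_nonneg unfolding symbol_fps_def by (intro renewal_sum_le_1 slow_fps_0 slow_fps_pos slow_fps_decseq)

lemma symbol_fps_0: "fps_nth symbol_fps 0 = 0"
  by (simp add: symbol_fps_def slow_fps_0)

lemma symbol_fps_1: "fps_nth symbol_fps 1 > 0"
proof -
  have "symbol_fps * slow_fps = slow_fps - 1"
    using inverse_mult_eq_1[of slow_fps] slow_fps_0 by (simp add: symbol_fps_def algebra_simps)
  then have "fps_nth (symbol_fps * slow_fps) 1 = fps_nth slow_fps 1"
    by simp
  then show ?thesis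
    using slow_fps_0 symbol_fps_0 slow_fps_pos[of 1] by (simp add: fps_mult_nth)
qed

lemma inverse_one_minus_symbol: "inverse (1 - symbol_fps) = slow_fps"
  by (simp add: symbol_fps_def slow_fps_0 fps_inverse_idempotent)

lemma symbol_fps_summable: "summable (fps_nth symbol_fps)"
  by (rule bounded_imp_summable[OF symbol_fps_nonneg symbol_fps_sum_le_1])

lemma symbol_fps_suminf: "suminf (fps_nth symbol_fps) \<le> 1"
  by (rule suminf_le_const[OF symbol_fps_summable])
   (metis symbol_fps_sum_le_1 symbol_fps_0 lessThan_Suc_atMost not0_implies_Suc sum.empty lessThan_0 zero_le_one)

section \<open>Radial behaviour of the generating functions near 1\<close>

lemma bounded_coeff_conv_radius:
  fixes F :: "'a :: {banach, real_normed_div_algebra} fps"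
  assumes "\<And>n. norm (fps_nth F n) \<le> B"
  shows "fps_conv_radius F \<ge> 1"
  unfolding fps_conv_radius_def
proof (rule conv_radius_geI_ex')
  fix r :: real assume r: "0 < r" "ereal r < 1"
  have "summable (\<lambda>n. B * r ^ n)"
    using r by (intro summable_mult summable_geometric) auto
  then show "summable (\<lambda>n. fps_nth F n * of_real r ^ n)"
    by (rule summable_comparison_test')
      (use r assms in \<open>auto simp: norm_mult norm_power intro!: mult_right_mono\<close>)
qed

lemma symbol_fps_le_1: "fps_nth symbol_fps n \<le> 1"
  using symbol_fps_sum_le_1[of n] sum_nonneg_leq_bound[of "{..n}" "fps_nth symbol_fps"] symbol_fps_nonneg
  by (smt (verit, best) atMost_iff finite_atMost member_le_sum order_refl)

lemma symbol_fps_radius: "fps_conv_radius symbol_fps \<ge> 1"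
  using symbol_fps_nonneg symbol_fps_le_1 by (intro bounded_coeff_conv_radius[of _ 1]) auto

lemma slow_fps_radius: "fps_conv_radius slow_fps \<ge> 1"
  using slow_fps_pos slow_fps_le_1 by (intro bounded_coeff_conv_radius[of _ 1]) (auto simp: less_imp_le)

lemma eval_symbol_slow:
  assumes "0 \<le> x" "x < (1::real)"
  shows "(1 - eval_fps symbol_fps x) * eval_fps slow_fps x = 1"
proof -
  have x: "ereal (norm x) < fps_conv_radius symbol_fps" "ereal (norm x) < fps_conv_radius slow_fps"
    using assms less_le_trans[OF _ symbol_fps_radius] less_le_trans[OF _ slow_fps_radius] by auto
  have "slow_fps = 1 + symbol_fps * slow_fps"
    using inverse_mult_eq_1[of slow_fps] slow_fps_0 by (simp add: symbol_fps_def algebra_simps)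
  then have "eval_fps slow_fps x = eval_fps (1 + symbol_fps * slow_fps) x" by simp
  also have "\<dots> = 1 + eval_fps symbol_fps x * eval_fps slow_fps x"
    using x fps_conv_radius_mult[of symbol_fps slow_fps] by (subst eval_fps_add) (auto simp: eval_fps_mult min_def split: if_splits intro: less_le_trans)
  finally show ?thesis by (simp add: algebra_simps)
qed

text \<open>Only the first \<open>N\<close> terms are kept, with \<open>N\<close> about
  \<open>1 / t\<close>. There every coefficient is at least \<open>1 / slow (2 / t)\<close>, and the
  geometric sum is at least \<open>1 / (2 * t)\<close>, because \<open>(1 - t) ^ N\<close> is at
  most exp(-1).\<close>

lemma eval_slow_fps_ge:
  assumes "0 < t" "t < (1::real)"
  shows "2 * t * slow (2 / t) * eval_fps slow_fps (1 - t) \<ge> 1"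
proof -
  define N where "N = nat \<lceil>1 / t\<rceil>"
  have N: "real N \<ge> 1 / t" "real N \<le> 1 / t + 1"
    using assms unfolding N_def by (auto simp: of_nat_nat)
  have N2: "real N \<le> 2 / t"
    using N(2) assms by (simp add: field_simps)
  have "summable (\<lambda>k. fps_nth slow_fps k * (1 - t) ^ k)"
    using assms by (intro summable_fps less_le_trans[OF _ slow_fps_radius]) auto
  then have "(\<Sum>k<N. fps_nth slow_fps k * (1 - t) ^ k) \<le> eval_fps slow_fps (1 - t)"
    unfolding eval_fps_def using assms slow_fps_pos by (intro sum_le_suminf) (auto simp: less_imp_le)
  moreover have "(\<Sum>k<N. (1 / slow (2 / t)) * (1 - t) ^ k) \<le> (\<Sum>k<N. fps_nth slow_fps k * (1 - t) ^ k)"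
  proof (intro sum_mono mult_right_mono)
    fix k assume "k \<in> {..<N}"
    then have "slow (real k) \<le> slow (2 / t)"
      using N2 by (intro slow_mono) auto
    then show "1 / slow (2 / t) \<le> fps_nth slow_fps k"
      using slow_ge_1[of "real k"] by (simp add: slow_fps_def frac_le)
  qed (use assms in auto)
  moreover have "(\<Sum>k<N. (1 - t) ^ k) = (1 - (1 - t) ^ N) / t"
    using assms by (simp add: sum_gp_strict)
  moreover have "(1 - t) ^ N \<le> 1 / 2"
  proof -
    have "(1 - t) ^ N \<le> exp (- t) ^ N"
      using assms exp_ge_add_one_self[of "- t"] by (intro power_mono) auto
    also have "\<dots> = exp (- (t * real N))"
      by (simp flip: exp_of_nat_mult add: mult.commute)
    also have "\<dots> \<le> exp (- 1)"
      using N(1) assms by (simp add: field_simps)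
    also have "\<dots> \<le> 1 / 2"
      using exp_ge_add_one_self[of 1] by (simp add: exp_minus field_simps)
    finally show ?thesis .
  qed
  ultimately have "(1 / slow (2 / t)) * ((1 / 2) / t) \<le> eval_fps slow_fps (1 - t)"
  proof -
    assume a: "(\<Sum>k<N. fps_nth slow_fps k * (1 - t) ^ k) \<le> eval_fps slow_fps (1 - t)"
      and b: "(\<Sum>k<N. (1 / slow (2 / t)) * (1 - t) ^ k) \<le> (\<Sum>k<N. fps_nth slow_fps k * (1 - t) ^ k)"
      and c: "(\<Sum>k<N. (1 - t) ^ k) = (1 - (1 - t) ^ N) / t" and d: "(1 - t) ^ N \<le> 1 / 2"
    have "(1 / slow (2 / t)) * ((1 / 2) / t) \<le> (1 / slow (2 / t)) * (\<Sum>k<N. (1 - t) ^ k)"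
      unfolding c using d assms slow_ge_1[of "2/t"] by (intro mult_left_mono divide_right_mono) auto
    with a b show ?thesis by (simp add: sum_distrib_left)
  qed
  moreover have "slow (2 / t) > 0" using slow_ge_1[of "2/t"] assms by simp
  ultimately show ?thesis
    using assms by (simp add: field_simps)
qed

text \<open>The first bound controls the ratio of 1 - \<phi>(1 - t) to \<open>t\<close> and carries
  the actual rate. The second, obtained from \<open>slow_le_sqrt\<close>, only serves to bound
  \<open>t\<close> below when 1 - \<phi>(1 - t) is prescribed; 48 is the square of 4 times 3, from
  \<open>2 * t * (2 * sqrt (3 / t))\<close>.\<close>

lemma one_minus_eval_symbol:
  assumes "0 < t" "t < (1::real)"
  shows "1 - eval_fps symbol_fps (1 - t) \<le> 2 * t * slow (2 / t)" "(1 - eval_fps symbol_fps (1 - t))\<^sup>2 \<le> 48 * t"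
    "1 - eval_fps symbol_fps (1 - t) > 0"
proof -
  define V where "V = eval_fps slow_fps (1 - t)"
  have eq: "(1 - eval_fps symbol_fps (1 - t)) * V = 1"
    using assms eval_symbol_slow[of "1 - t"] by (simp add: V_def)
  have ge: "2 * t * slow (2 / t) * V \<ge> 1"
    using assms eval_slow_fps_ge[of t] by (simp add: V_def)
  have s: "slow (2 / t) > 0" using slow_ge_1[of "2/t"] assms by simp
  have V: "V > 0" using ge s assms
    by (smt (verit) mult_pos_pos mult_nonneg_nonpos)
  show 1: "1 - eval_fps symbol_fps (1 - t) \<le> 2 * t * slow (2 / t)"
    using eq ge V by (metis mult_le_cancel_right_pos)
  show 2: "1 - eval_fps symbol_fps (1 - t) > 0"
    using eq V by (metis zero_less_mult_pos2 zero_less_one)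
  have "slow (2 / t) \<le> 2 * sqrt (1 + 2 / t)"
    using assms by (intro slow_le_sqrt) auto
  also have "\<dots> \<le> 2 * sqrt (3 / t)"
    using assms by (auto simp: field_simps)
  finally have "1 - eval_fps symbol_fps (1 - t) \<le> 2 * t * (2 * sqrt (3 / t))"
    using 1 mult_left_mono[of "slow (2/t)" _ "2 * t"] assms by (smt (verit))
  then have "(1 - eval_fps symbol_fps (1 - t))\<^sup>2 \<le> (2 * t * (2 * sqrt (3 / t)))\<^sup>2"
    using 2 by (intro power_mono) auto
  also have "\<dots> = 48 * t"
    using assms by (simp add: power_mult_distrib power2_eq_square[of t])
  finally show "(1 - eval_fps symbol_fps (1 - t))\<^sup>2 \<le> 48 * t" .
qed

section \<open>Composition on the Hardy space\<close>

lemma fps_power_nonneg: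
  fixes P :: "real fps"
  assumes "\<And>k. fps_nth P k \<ge> 0"
  shows "fps_nth (P ^ n) k \<ge> 0"
  by (induction n arbitrary: k) (auto simp: fps_mult_nth assms intro!: sum_nonneg)

text \<open>The coefficients of a product run over a triangle of index pairs. For nonnegative
  coefficients the triangle may be enlarged to the square, where the sum factors.\<close>

lemma fps_power_sum_le_1:
  fixes P :: "real fps"
  assumes nonneg: "\<And>k. fps_nth P k \<ge> 0" and le: "\<And>m. (\<Sum>k\<le>m. fps_nth P k) \<le> 1"
  shows "(\<Sum>k\<le>m. fps_nth (P ^ n) k) \<le> 1"
proof (induction n)
  case 0
  then show ?case by (simp add: sum.delta)
next
  case (Suc n)
  have "(\<Sum>k\<le>m. fps_nth (P ^ Suc n) k) = (\<Sum>k\<le>m. \<Sum>i\<le>k. fps_nth P i * fps_nth (P ^ n) (k - i))"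
    by (simp add: fps_mult_nth atLeast0AtMost)
  also have "\<dots> = (\<Sum>(i, j)\<in>{(i, j). i + j \<le> m}. fps_nth P i * fps_nth (P ^ n) j)"
    by (rule sum.triangle_reindex_eq[symmetric])
  also have "\<dots> \<le> (\<Sum>(i, j)\<in>{..m} \<times> {..m}. fps_nth P i * fps_nth (P ^ n) j)"
    by (intro sum_mono2) (auto intro!: mult_nonneg_nonneg nonneg fps_power_nonneg)
  also have "\<dots> = (\<Sum>k\<le>m. fps_nth P k) * (\<Sum>k\<le>m. fps_nth (P ^ n) k)"
    by (simp add: sum_product sum.cartesian_product)
  also have "\<dots> \<le> 1 * 1"
    by (intro mult_mono le Suc.IH sum_nonneg fps_power_nonneg nonneg) auto
  finally show ?case by simp
qed

text \<open>Coefficients of the geometric series composed with \<open>P\<close>. The sum stops at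
  \<open>n = k\<close> because \<open>P ^ n\<close> has no terms below degree
  \<open>n\<close>.\<close>

lemma fps_power_sum_eq:
  fixes P :: "real fps"
  assumes "fps_nth P 0 = 0"
  shows "(\<Sum>n\<le>k. fps_nth (P ^ n) k) = fps_nth (inverse (1 - P)) k"
proof -
  have "Abs_fps (\<lambda>n. 1) oo P = inverse (1 - P)"
    using gp[OF assms] assms by (simp add: fps_divide_unit)
  from arg_cong[OF this, of "\<lambda>F. fps_nth F k"] show ?thesis
    by (simp add: fps_compose_nth atLeast0AtMost)
qed

text \<open>Schur test for the matrix of coefficients of the powers of \<open>P\<close>: its row sums are the
  coefficients of \<open>1 / (1 - P)\<close> and its column sums are at most 1.\<close>

lemma schur_power_matrix:
  fixes P :: "real fps" and c :: "nat \<Rightarrow> complex"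
  assumes P0: "fps_nth P 0 = 0" and nonneg: "\<And>k. fps_nth P k \<ge> 0"
    and le: "\<And>m. (\<Sum>k\<le>m. fps_nth P k) \<le> 1" and dec: "decseq (fps_nth (inverse (1 - P)))"
    and c: "summable (\<lambda>n. (cmod (c n))\<^sup>2)"
  shows "(\<Sum>k=K..<M. (cmod (\<Sum>n\<le>k. c n * of_real (fps_nth (P ^ n) k)))\<^sup>2)
         \<le> fps_nth (inverse (1 - P)) K * (\<Sum>n. (cmod (c n))\<^sup>2)"
proof -
  define A where "A n k = fps_nth (P ^ n) k" for n k
  define u where "u = fps_nth (inverse (1 - P))"
  have A: "A n k \<ge> 0" for n k
    unfolding A_def by (rule fps_power_nonneg[OF nonneg])
  have u: "u k = (\<Sum>n\<le>k. A n k)" for k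
    by (simp add: A_def u_def fps_power_sum_eq[OF P0])
  have u0: "u k \<ge> 0" for k
    unfolding u by (intro sum_nonneg A)
  have "(cmod (\<Sum>n\<le>k. c n * of_real (A n k)))\<^sup>2 \<le> u K * (\<Sum>n\<le>M. A n k * (cmod (c n))\<^sup>2)"
    if "k \<in> {K..<M}" for k
  proof -
    have "cmod (\<Sum>n\<le>k. c n * of_real (A n k)) \<le> (\<Sum>n\<le>k. sqrt (A n k) * (sqrt (A n k) * cmod (c n)))"
      using A by (intro sum_norm_le) (simp add: norm_mult mult_ac flip: mult.assoc)
    then have "(cmod (\<Sum>n\<le>k. c n * of_real (A n k)))\<^sup>2 \<le> (\<Sum>n\<le>k. sqrt (A n k) * (sqrt (A n k) * cmod (c n)))\<^sup>2"
      by (intro power_mono) auto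
    also have "\<dots> \<le> (\<Sum>n\<le>k. (sqrt (A n k))\<^sup>2) * (\<Sum>n\<le>k. (sqrt (A n k) * cmod (c n))\<^sup>2)"
      by (rule Cauchy_Schwarz_ineq_sum)
    also have "\<dots> = u k * (\<Sum>n\<le>k. A n k * (cmod (c n))\<^sup>2)"
      using A by (simp add: u power_mult_distrib)
    \<comment> \<open>Two enlargements at once: \<open>u k \<le> u K\<close> extracts the factor
      that makes tails small, and the range \<open>n \<le> M\<close> no longer depends on
      \<open>k\<close>, so that the two sums can be exchanged.\<close>
    also have "\<dots> \<le> u K * (\<Sum>n\<le>M. A n k * (cmod (c n))\<^sup>2)"
    proof (intro mult_mono sum_mono2)
      show "u k \<le> u K" using that dec by (simp add: u_def decseqD)
    qed (use that A u0 in \<open>auto intro!: sum_nonneg\<close>)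
    finally show ?thesis .
  qed
  then have "(\<Sum>k=K..<M. (cmod (\<Sum>n\<le>k. c n * of_real (A n k)))\<^sup>2)
      \<le> (\<Sum>k=K..<M. u K * (\<Sum>n\<le>M. A n k * (cmod (c n))\<^sup>2))"
    by (rule sum_mono)
  also have "\<dots> = u K * (\<Sum>n\<le>M. (cmod (c n))\<^sup>2 * (\<Sum>k=K..<M. A n k))"
    unfolding sum_distrib_left by (subst sum.swap) (simp add: mult_ac)
  also have "\<dots> \<le> u K * (\<Sum>n\<le>M. (cmod (c n))\<^sup>2 * 1)"
  proof (intro mult_left_mono sum_mono u0)
    fix n
    have "(\<Sum>k=K..<M. A n k) \<le> (\<Sum>k\<le>M. A n k)"
      by (intro sum_mono2 A) auto
    also have "\<dots> \<le> 1"
      unfolding A_def by (rule fps_power_sum_le_1[OF nonneg le])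
    finally show "(\<Sum>k=K..<M. A n k) \<le> 1" .
  qed auto
  also have "\<dots> \<le> u K * (\<Sum>n. (cmod (c n))\<^sup>2)"
    using c by (intro mult_left_mono u0) (auto intro!: sum_le_suminf)
  finally show ?thesis
    by (simp add: A_def u_def)
qed

section \<open>Passing between functions on the disc and their coefficients\<close>

lemma disc_holo_has_fps_expansion:
  "f \<in> disc_holo \<Longrightarrow> f has_fps_expansion fps_expansion f 0"
  by (rule has_fps_expansion_fps_expansion[of "ball 0 1"]) (auto simp: disc_holo_def)

lemma fps_expansion_eqI_0:
  "f has_fps_expansion F \<Longrightarrow> fps_expansion f 0 = F"
  by (metis fps_expansion_eqI)

lemma disc_holo_add: "f \<in> disc_holo \<Longrightarrow> g \<in> disc_holo \<Longrightarrow> f + g \<in> disc_holo"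
  by (auto simp: disc_holo_def plus_fun_def intro!: holomorphic_intros)

lemma fps_expansion_diff_disc_holo:
  assumes "f \<in> disc_holo" "g \<in> disc_holo"
  shows "fps_expansion (f - g) 0 = fps_expansion f 0 - fps_expansion g 0"
  using has_fps_expansion_diff[OF assms[THEN disc_holo_has_fps_expansion]]
  by (intro fps_expansion_eqI_0) (simp add: fun_diff_def)

lemma comp_op_disc_holo:
  assumes "\<phi> holomorphic_on ball 0 1" "\<phi> \<in> ball 0 1 \<rightarrow> ball 0 1" "f \<in> disc_holo"
  shows "comp_op \<phi> f \<in> disc_holo"
proof -
  have "(f \<circ> \<phi>) holomorphic_on ball 0 1"
    using assms by (intro holomorphic_on_compose_gen[of _ _ _ "ball 0 1"]) (auto simp: disc_holo_def)
  moreover have "(f \<circ> \<phi>) holomorphic_on ball 0 1 \<longleftrightarrow> comp_op \<phi> f holomorphic_on ball 0 1"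
    by (rule holomorphic_cong) (auto simp: comp_op_def)
  ultimately show ?thesis
    by (auto simp: disc_holo_def comp_op_def)
qed

lemma comp_op_add: "comp_op \<phi> (f + g) = comp_op \<phi> f + comp_op \<phi> g"
  by (auto simp: comp_op_def fun_eq_iff)

lemma comp_op_scale: "comp_op \<phi> (cfun_scale c f) = cfun_scale c (comp_op \<phi> f)"
  by (auto simp: comp_op_def fun_eq_iff cfun_scale_def)

lemma fps_expansion_comp_op:
  assumes "\<phi> has_fps_expansion G" "fps_nth G 0 = 0" "f \<in> disc_holo"
  shows "fps_expansion (comp_op \<phi> f) 0 = fps_expansion f 0 oo G"
proof (rule fps_expansion_eqI_0)
  have "(f \<circ> \<phi>) has_fps_expansion (fps_expansion f 0 oo G)"
    using assms by (intro has_fps_expansion_compose disc_holo_has_fps_expansion)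
  moreover have "(f \<circ> \<phi>) has_fps_expansion (fps_expansion f 0 oo G) \<longleftrightarrow>
      comp_op \<phi> f has_fps_expansion (fps_expansion f 0 oo G)"
  proof (rule has_fps_expansion_cong)
    have "\<forall>\<^sub>F x in nhds (0::complex). x \<in> ball 0 1"
      by (rule eventually_nhds_in_open) auto
    then show "\<forall>\<^sub>F x in nhds 0. (f \<circ> \<phi>) x = comp_op \<phi> f x"
      by eventually_elim (simp add: comp_op_def)
  qed simp
  ultimately show "comp_op \<phi> f has_fps_expansion (fps_expansion f 0 oo G)"
    by simp
qed

text \<open>Needed to turn a coefficientwise limit back into a function of the space. Square
  summable coefficients are bounded, so the series converges on the whole disc.\<close>

lemma hardy_of_coeffs:
  assumes c: "summable (\<lambda>k. (cmod (c k))\<^sup>2)"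
  obtains g where "g \<in> hardy" "fps_expansion g 0 = Abs_fps c"
proof -
  define g where "g z = (if z \<in> ball 0 1 then eval_fps (Abs_fps c) z else 0)" for z
  have "cmod (c k) \<le> sqrt (\<Sum>k. (cmod (c k))\<^sup>2)" for k
    using sum_le_suminf[OF c, of "{k}"] by (intro real_le_rsqrt) auto
  then have rad: "fps_conv_radius (Abs_fps c) \<ge> 1"
    by (intro bounded_coeff_conv_radius[of _ "sqrt (\<Sum>k. (cmod (c k))\<^sup>2)"]) auto
  have "ball (0::complex) 1 \<subseteq> eball 0 (fps_conv_radius (Abs_fps c))"
  proof
    fix z :: complex assume "z \<in> ball 0 1"
    then have "ereal (dist 0 z) < 1" by simp
    then show "z \<in> eball 0 (fps_conv_radius (Abs_fps c))"
      unfolding in_eball_iff using rad by (rule less_le_trans)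
  qed
  then have "eval_fps (Abs_fps c) holomorphic_on ball 0 1"
    by (rule holomorphic_on_eval_fps)
  moreover have "eval_fps (Abs_fps c) holomorphic_on ball 0 1 \<longleftrightarrow> g holomorphic_on ball 0 1"
    by (rule holomorphic_cong) (auto simp: g_def)
  ultimately have "g \<in> disc_holo"
    by (auto simp: disc_holo_def g_def)
  have "g has_fps_expansion Abs_fps c"
    unfolding has_fps_expansion_def
  proof
    show "fps_conv_radius (Abs_fps c) > 0"
      using rad by (rule less_le_trans[rotated]) simp
    have "\<forall>\<^sub>F x in nhds (0::complex). x \<in> ball 0 1"
      by (rule eventually_nhds_in_open) auto
    then show "\<forall>\<^sub>F z in nhds 0. eval_fps (Abs_fps c) z = g z"
      by eventually_elim (simp add: g_def)
  qed
  then have *: "fps_expansion g 0 = Abs_fps c"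
    by (rule fps_expansion_eqI_0)
  show ?thesis
    by (rule that[OF _ *]) (use \<open>g \<in> disc_holo\<close> c * in \<open>simp add: hardy_def\<close>)
qed

lemma fps_power_of_real:
  "Abs_fps (\<lambda>k. complex_of_real (fps_nth P k)) ^ n = Abs_fps (\<lambda>k. of_real (fps_nth (P ^ n) k))"
  by (induction n) (auto simp: fps_eq_iff fps_mult_nth)

lemma summable_norm_diff_squared:
  fixes a b :: "nat \<Rightarrow> complex"
  assumes a: "summable (\<lambda>n. (cmod (a n))\<^sup>2)" and b: "summable (\<lambda>n. (cmod (b n))\<^sup>2)"
  shows "summable (\<lambda>n. (cmod (a n - b n))\<^sup>2)"
    and "(\<Sum>n. (cmod (a n - b n))\<^sup>2) \<le> 2 * (\<Sum>n. (cmod (a n))\<^sup>2) + 2 * (\<Sum>n. (cmod (b n))\<^sup>2)"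
proof -
  have le: "(cmod (a n - b n))\<^sup>2 \<le> 2 * (cmod (a n))\<^sup>2 + 2 * (cmod (b n))\<^sup>2" for n
  proof -
    have "(cmod (a n - b n))\<^sup>2 \<le> (cmod (a n) + cmod (b n))\<^sup>2"
      by (intro power_mono norm_triangle_ineq4) auto
    also have "\<dots> \<le> 2 * (cmod (a n))\<^sup>2 + 2 * (cmod (b n))\<^sup>2"
      using zero_le_power2[of "cmod (a n) - cmod (b n)"] by (simp add: power2_eq_square algebra_simps)
    finally show ?thesis .
  qed
  have s: "summable (\<lambda>n. 2 * (cmod (a n))\<^sup>2 + 2 * (cmod (b n))\<^sup>2)"
    by (intro summable_add summable_mult a b)
  show s': "summable (\<lambda>n. (cmod (a n - b n))\<^sup>2)"
    by (rule summable_comparison_test'[OF s, of 0]) (use le in auto)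
  have "(\<Sum>n. (cmod (a n - b n))\<^sup>2) \<le> (\<Sum>n. 2 * (cmod (a n))\<^sup>2 + 2 * (cmod (b n))\<^sup>2)"
    by (rule suminf_le[OF le s' s])
  also have "\<dots> = 2 * (\<Sum>n. (cmod (a n))\<^sup>2) + 2 * (\<Sum>n. (cmod (b n))\<^sup>2)"
    using suminf_add[OF summable_mult[OF a, of 2] summable_mult[OF b, of 2]] suminf_mult[OF a, of 2] suminf_mult[OF b, of 2]
    by simp
  finally show "(\<Sum>n. (cmod (a n - b n))\<^sup>2) \<le> 2 * (\<Sum>n. (cmod (a n))\<^sup>2) + 2 * (\<Sum>n. (cmod (b n))\<^sup>2)" .
qed

text \<open>A norm-bounded sequence has a subsequence whose coefficients all converge, by a diagonal
  argument, and the limit sequence \<open>l\<close> is square summable with the same bound. Applied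
  to the differences \<open>d n\<close>, the Schur test bounds the tail of the image beyond
  \<open>k\<close> by \<open>u k\<close> times a constant, uniformly in \<open>n\<close>; finitely
  many coefficients remain, and each tends to 0.\<close>

lemma compact_comp_op_hardy:
  fixes P :: "real fps"
  assumes P0: "fps_nth P 0 = 0" and nonneg: "\<And>k. fps_nth P k \<ge> 0"
    and le: "\<And>m. (\<Sum>k\<le>m. fps_nth P k) \<le> 1" and dec: "decseq (fps_nth (inverse (1 - P)))"
    and lim: "fps_nth (inverse (1 - P)) \<longlonglongrightarrow> 0"
    and holo: "\<phi> holomorphic_on ball 0 1" "\<phi> \<in> ball 0 1 \<rightarrow> ball 0 1"
    and exp: "\<phi> has_fps_expansion Abs_fps (\<lambda>k. of_real (fps_nth P k))"
  shows "compact_op hardy hardy_norm (comp_op \<phi>)"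
proof -
  define T where "T c k = (\<Sum>n\<le>k. c n * of_real (fps_nth (P ^ n) k))" for c :: "nat \<Rightarrow> complex" and k
  define S where "S c = (\<Sum>k. (cmod (c k))\<^sup>2)" for c :: "nat \<Rightarrow> complex"
  define l2 where "l2 c \<longleftrightarrow> summable (\<lambda>k. (cmod (c k))\<^sup>2)" for c :: "nat \<Rightarrow> complex"
  define cf where "cf f = fps_nth (fps_expansion f 0)" for f
  define u where "u = fps_nth (inverse (1 - P))"
  have norm_eq: "hardy_norm f = sqrt (S (cf f))" for f
    by (simp add: hardy_norm_def S_def cf_def)
  have hardy_iff: "f \<in> hardy \<longleftrightarrow> f \<in> disc_holo \<and> l2 (cf f)" for f
    by (simp add: hardy_def l2_def cf_def)
  have S_nonneg: "S c \<ge> 0" if "l2 c" for c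
    using that by (auto simp: S_def l2_def intro!: suminf_nonneg)
  have cf_comp: "cf (comp_op \<phi> f) = T (cf f)" if "f \<in> disc_holo" for f
    using that P0 unfolding cf_def
    by (subst fps_expansion_comp_op[OF exp])
      (auto simp: T_def fun_eq_iff fps_compose_nth fps_power_of_real atLeast0AtMost)
  have schur: "(\<Sum>k=K..<M. (cmod (T c k))\<^sup>2) \<le> u K * S c" if "l2 c" for c K M
    unfolding T_def u_def S_def using that unfolding l2_def
    by (rule schur_power_matrix[OF P0 nonneg le dec])
  have l2_T: "l2 (T c)" and S_T_tail: "(\<Sum>k. (cmod (T c (k + K)))\<^sup>2) \<le> u K * S c" if c: "l2 c" for c K
  proof -
    show *: "l2 (T c)"
      unfolding l2_def
    proof (rule bounded_imp_summable)
      fix n show "(\<Sum>k\<le>n. (cmod (T c k))\<^sup>2) \<le> u 0 * S c"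
        using schur[OF c, of 0 "Suc n"] by (simp add: atLeast0LessThan lessThan_Suc_atMost)
    qed auto
    show "(\<Sum>k. (cmod (T c (k + K)))\<^sup>2) \<le> u K * S c"
    proof (rule suminf_le_const)
      show "summable (\<lambda>k. (cmod (T c (k + K)))\<^sup>2)"
        using * unfolding l2_def by (rule summable_ignore_initial_segment)
      show "(\<Sum>k<n. (cmod (T c (k + K)))\<^sup>2) \<le> u K * S c" for n
        using schur[OF c, of K "n + K"] sum.shift_bounds_nat_ivl[of "\<lambda>k. (cmod (T c k))\<^sup>2" 0 K n]
        by (simp add: atLeast0LessThan)
    qed
  qed
  have mem: "comp_op \<phi> f \<in> hardy" if "f \<in> hardy" for f
    using that comp_op_disc_holo[OF holo, of f] l2_T[of "cf f"] cf_comp[of f] by (simp add: hardy_iff)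
  have bdd: "bounded_op hardy hardy_norm (comp_op \<phi>)"
    unfolding bounded_op_def
  proof (intro conjI ballI allI exI)
    fix f assume f: "f \<in> hardy"
    then have "S (T (cf f)) \<le> u 0 * S (cf f)"
      using S_T_tail[of "cf f" 0] by (simp add: hardy_iff S_def)
    then show "hardy_norm (comp_op \<phi> f) \<le> sqrt (u 0) * hardy_norm f"
      using f by (simp add: norm_eq cf_comp hardy_iff flip: real_sqrt_mult)
  qed (simp_all add: mem comp_op_add comp_op_scale)
  moreover have "\<exists>g\<in>hardy. \<exists>r. strict_mono r \<and> (\<lambda>n. hardy_norm (comp_op \<phi> (F (r n)) - g)) \<longlonglongrightarrow> 0"
    if F: "\<forall>n::nat. F n \<in> hardy \<and> hardy_norm (F n) \<le> K" for F K
  proof -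
    have Fd: "F n \<in> disc_holo" and Fl: "l2 (cf (F n))" for n
      using F by (auto simp: hardy_iff)
    have SF: "S (cf (F n)) \<le> K\<^sup>2" for n
    proof -
      have "sqrt (S (cf (F n))) \<le> K"
        using F by (simp add: norm_eq)
      then have "(sqrt (S (cf (F n))))\<^sup>2 \<le> K\<^sup>2"
        using S_nonneg[OF Fl[of n]] by (intro power_mono) auto
      then show ?thesis using S_nonneg[OF Fl[of n]] by simp
    qed
    have cf_le: "cmod (cf (F n) k) \<le> \<bar>K\<bar>" for n k
    proof -
      have "(cmod (cf (F n) k))\<^sup>2 \<le> S (cf (F n))"
        using sum_le_suminf[of "\<lambda>k. (cmod (cf (F n) k))\<^sup>2" "{k}"] Fl[of n] by (simp add: S_def l2_def)
      also have "\<dots> \<le> \<bar>K\<bar>\<^sup>2" using SF by simp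
      finally show ?thesis by (rule power2_le_imp_le) simp
    qed
    obtain r where r: "strict_mono r" and "\<And>k. \<exists>l. (\<lambda>n. cf (F (r n)) k) \<longlonglongrightarrow> l"
      using function_convergent_subsequence[of "UNIV :: nat set" "\<lambda>n k. cf (F n) k" "\<bar>K\<bar>"] cf_le by auto
    then obtain l where l: "\<And>k. (\<lambda>n. cf (F (r n)) k) \<longlonglongrightarrow> l k"
      by metis
    have l_sum: "(\<Sum>k\<le>m. (cmod (l k))\<^sup>2) \<le> K\<^sup>2" for m
    proof (rule LIMSEQ_le_const2)
      show "(\<lambda>n. \<Sum>k\<le>m. (cmod (cf (F (r n)) k))\<^sup>2) \<longlonglongrightarrow> (\<Sum>k\<le>m. (cmod (l k))\<^sup>2)"
        by (intro tendsto_intros l)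
      have "(\<Sum>k\<le>m. (cmod (cf (F (r n)) k))\<^sup>2) \<le> S (cf (F (r n)))" for n
        unfolding S_def using Fl[of "r n"] by (intro sum_le_suminf) (auto simp: l2_def)
      then show "\<exists>N. \<forall>n\<ge>N. (\<Sum>k\<le>m. (cmod (cf (F (r n)) k))\<^sup>2) \<le> K\<^sup>2"
        using SF order_trans by blast
    qed
    have ll: "l2 l"
      unfolding l2_def by (rule bounded_imp_summable[OF _ l_sum]) auto
    have Sl: "S l \<le> K\<^sup>2"
      unfolding S_def
    proof (rule suminf_le_const)
      show "(\<Sum>k<n. (cmod (l k))\<^sup>2) \<le> K\<^sup>2" for n
        using l_sum[of n] by (smt (verit) lessThan_Suc_atMost sum.lessThan_Suc zero_le_power2)
    qed (use ll in \<open>simp add: l2_def\<close>)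
    obtain g where g: "g \<in> hardy" and "fps_expansion g 0 = Abs_fps l"
      using hardy_of_coeffs ll unfolding l2_def by metis
    then have cf_g: "cf g = l" by (simp add: cf_def fun_eq_iff)
    define d where "d n k = cf (F (r n)) k - l k" for n k
    have d: "l2 (d n)" and Sd: "S (d n) \<le> 4 * K\<^sup>2" for n
      using summable_norm_diff_squared[of "cf (F (r n))" l] Fl[of "r n"] ll SF[of "r n"] Sl
      by (auto simp: d_def S_def l2_def)
    have d_lim: "(\<lambda>n. d n k) \<longlonglongrightarrow> 0" for k
      using tendsto_diff[OF l tendsto_const, of k "l k"] by (simp add: d_def)
    \<comment> \<open>Coefficient \<open>k\<close> of the image is a finite combination of the
      coefficients of the argument up to \<open>k\<close>, so coefficientwise convergence is
      inherited.\<close>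
    have T_lim: "(\<lambda>n. T (d n) k) \<longlonglongrightarrow> 0" for k
      unfolding T_def by (rule tendsto_eq_intros d_lim refl | simp)+
    have "cf (comp_op \<phi> (F (r n)) - comp_op \<phi> g) = T (d n)" for n
    proof -
      have "cf (comp_op \<phi> (F (r n)) - comp_op \<phi> g) k = T (cf (F (r n))) k - T l k" for k
        using fps_expansion_diff_disc_holo[of "comp_op \<phi> (F (r n))" "comp_op \<phi> g"]
          mem[of "F (r n)"] mem[OF g] F g cf_comp[of "F (r n)"] cf_comp[of g] cf_g
        by (simp add: hardy_iff cf_def)
      then show ?thesis
        by (simp add: fun_eq_iff T_def d_def sum_subtractf algebra_simps)
    qed
    then have eq: "hardy_norm (comp_op \<phi> (F (r n)) - comp_op \<phi> g) = sqrt (S (T (d n)))" for n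
      by (simp add: norm_eq)
    have "(\<lambda>n. S (T (d n))) \<longlonglongrightarrow> 0"
    proof (rule LIMSEQ_I)
      fix e :: real assume e: "e > 0"
      have "(\<lambda>k. u k * (4 * K\<^sup>2)) \<longlonglongrightarrow> 0 * (4 * K\<^sup>2)"
        unfolding u_def by (intro tendsto_intros lim)
      then have "\<forall>\<^sub>F k in sequentially. u k * (4 * K\<^sup>2) < e / 2"
        by (rule order_tendstoD) (use e in auto)
      then obtain k where k: "u k * (4 * K\<^sup>2) < e / 2"
        by (metis eventually_sequentially order_refl)
      have uk: "u k \<ge> 0"
        using decseq_ge[OF dec lim] by (simp add: u_def)
      have "(\<lambda>n. \<Sum>i<k. (cmod (T (d n) i))\<^sup>2) \<longlonglongrightarrow> (\<Sum>i<k. (cmod 0)\<^sup>2)"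
        by (intro tendsto_intros T_lim)
      then have "\<forall>\<^sub>F n in sequentially. (\<Sum>i<k. (cmod (T (d n) i))\<^sup>2) < e / 2"
        by (rule order_tendstoD) (use e in auto)
      then obtain N where N: "\<And>n. n \<ge> N \<Longrightarrow> (\<Sum>i<k. (cmod (T (d n) i))\<^sup>2) < e / 2"
        by (auto simp: eventually_sequentially)
      have "norm (S (T (d n)) - 0) < e" if "n \<ge> N" for n
      proof -
        have "S (T (d n)) = (\<Sum>i. (cmod (T (d n) (i + k)))\<^sup>2) + (\<Sum>i<k. (cmod (T (d n) i))\<^sup>2)"
          unfolding S_def using l2_T[OF d[of n]] unfolding l2_def by (rule suminf_split_initial_segment)
        also have "\<dots> \<le> u k * S (d n) + (\<Sum>i<k. (cmod (T (d n) i))\<^sup>2)"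
          using S_T_tail[OF d[of n], of k] by simp
        also have "\<dots> < e / 2 + e / 2"
          using N[OF that] k mult_left_mono[OF Sd[of n] uk] by simp
        finally show ?thesis
          using S_nonneg[OF l2_T[OF d[of n]]] by simp
      qed
      then show "\<exists>N. \<forall>n\<ge>N. norm (S (T (d n)) - 0) < e" by blast
    qed
    then have "(\<lambda>n. hardy_norm (comp_op \<phi> (F (r n)) - comp_op \<phi> g)) \<longlonglongrightarrow> 0"
      unfolding eq using tendsto_real_sqrt by force
    then show ?thesis
      using mem[OF g] r by blast
  qed
  ultimately show ?thesis
    unfolding compact_op_def by blast
qed

section \<open>Approximation numbers on the Bergman space\<close>

lemma sum_fun_apply: "(\<Sum>i\<in>A. f i) x = (\<Sum>i\<in>A. f i (x :: 'b) :: 'a :: comm_monoid_add)"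
  by (induction A rule: infinite_finite_induct) auto

text \<open>Dependence in the library is a property of sets, while a relation indexed by
  \<open>j < n\<close> is wanted. A repeated vector is therefore treated separately: its two
  occurrences cancel.\<close>

lemma nontrivial_relation_in_span:
  fixes h :: "nat \<Rightarrow> complex \<Rightarrow> complex"
  assumes B: "finite B" "card B < n" and h: "\<And>j. j < n \<Longrightarrow> h j \<in> cfun.span B"
  obtains c where "\<exists>j<n. c j \<noteq> 0" "\<And>z. (\<Sum>j<n. c j * h j z) = 0"
proof (cases "inj_on h {..<n}")
  case False
  then obtain i j where ij: "i < n" "j < n" "i \<noteq> j" "h i = h j"
    by (auto simp: inj_on_def)
  define c :: "nat \<Rightarrow> complex" where "c k = (if k = i then 1 else 0) - (if k = j then 1 else 0)" for k
  show ?thesis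
  proof (rule that[of c])
    show "\<exists>j<n. c j \<noteq> 0" using ij by (auto simp: c_def)
    show "(\<Sum>j<n. c j * h j z) = 0" for z
      using ij by (simp add: c_def left_diff_distrib sum_subtractf if_distrib[of "\<lambda>x. x * _"] cong: if_cong)
  qed
next
  case True
  have "cfun.dependent (h ` {..<n})"
  proof (rule ccontr)
    assume "\<not> cfun.dependent (h ` {..<n})"
    then have "card (h ` {..<n}) \<le> card B"
      using cfun.independent_span_bound[OF B(1), of "h ` {..<n}"] h by auto
    then show False using B(2) True by (simp add: card_image)
  qed
  then obtain t u where t: "t \<subseteq> h ` {..<n}" "(\<Sum>v\<in>t. cfun_scale (u v) v) = 0" and nz: "\<exists>v\<in>t. u v \<noteq> 0"
    unfolding cfun.dependent_explicit by blast
  define c where "c j = (if h j \<in> t then u (h j) else 0)" for j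
  show ?thesis
  proof (rule that[of c])
    show "\<exists>j<n. c j \<noteq> 0" using t(1) nz by (force simp: c_def)
    fix z
    have "(\<Sum>j<n. c j * h j z) = (\<Sum>v\<in>h ` {..<n}. (if v \<in> t then u v else 0) * v z)"
      by (simp add: sum.reindex[OF True] c_def)
    also have "\<dots> = (\<Sum>v\<in>t. u v * v z)"
      using t(1) by (intro sum.mono_neutral_cong_right) auto
    also have "\<dots> = (\<Sum>v\<in>t. cfun_scale (u v) v) z"
      by (simp add: sum_fun_apply cfun_scale_def)
    also have "\<dots> = 0" by (simp add: t(2))
    finally show "(\<Sum>j<n. c j * h j z) = 0" .
  qed
qed

section \<open>The Bergman space inside L^2 of the plane\<close>

lemma disc_holo_measurable:
  assumes "f \<in> disc_holo" shows "f \<in> borel_measurable borel"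
proof -
  have "(\<lambda>z. indicator (ball 0 1) z *\<^sub>R f z) \<in> borel_measurable borel"
    using assms by (intro borel_measurable_continuous_on_indicator)
      (auto simp: disc_holo_def intro: holomorphic_on_imp_continuous_on)
  moreover have "(\<lambda>z. indicator (ball 0 1) z *\<^sub>R f z) = f"
    using assms by (auto simp: disc_holo_def indicator_def fun_eq_iff)
  ultimately show ?thesis by simp
qed

text \<open>Since functions are extended by 0, integrals over the disc become integrals over the
  plane, and the set integrals of the definitions disappear from the later arguments.\<close>

lemma disc_holo_indicator:
  "f \<in> disc_holo \<Longrightarrow> (\<lambda>z. indicator (ball 0 1) z * (cmod (f z))\<^sup>2) = (\<lambda>z. (cmod (f z))\<^sup>2)"
  by (auto simp: disc_holo_def indicator_def fun_eq_iff)

lemma bergman_iff: "f \<in> bergman \<longleftrightarrow> f \<in> disc_holo \<and> integrable lborel (\<lambda>z. (cmod (f z))\<^sup>2)"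
  by (auto simp: bergman_def set_integrable_def disc_holo_indicator)

lemma bergman_norm_eq:
  "f \<in> disc_holo \<Longrightarrow> bergman_norm f = sqrt ((LINT z|lborel. (cmod (f z))\<^sup>2) / pi)"
  by (simp add: bergman_norm_def set_lebesgue_integral_def disc_holo_indicator)

lemma norm_add_squared_le: "(cmod (a + b))\<^sup>2 \<le> 2 * (cmod a)\<^sup>2 + 2 * (cmod b)\<^sup>2"
proof -
  have "(cmod (a + b))\<^sup>2 \<le> (cmod a + cmod b)\<^sup>2"
    by (intro power_mono norm_triangle_ineq) auto
  also have "\<dots> \<le> 2 * (cmod a)\<^sup>2 + 2 * (cmod b)\<^sup>2"
    using zero_le_power2[of "cmod a - cmod b"] by (simp add: power2_eq_square algebra_simps)
  finally show ?thesis .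
qed

text \<open>A weak substitute for the triangle inequality. Its factor 2 is harmless: it serves only
  for closure under sums and for the finiteness of suprema that define operator norms.\<close>

lemma bergman_add:
  assumes "f \<in> bergman" "g \<in> bergman"
  shows "f + g \<in> bergman"
    and "(bergman_norm (f + g))\<^sup>2 \<le> 2 * (bergman_norm f)\<^sup>2 + 2 * (bergman_norm g)\<^sup>2"
proof -
  have d: "f \<in> disc_holo" "g \<in> disc_holo" "f + g \<in> disc_holo"
    and i: "integrable lborel (\<lambda>z. (cmod (f z))\<^sup>2)" "integrable lborel (\<lambda>z. (cmod (g z))\<^sup>2)"
    using assms by (auto simp: bergman_iff disc_holo_add)
  note [measurable] = disc_holo_measurable[OF d(3)]
  have i3: "integrable lborel (\<lambda>z. (cmod ((f + g) z))\<^sup>2)"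
  proof (rule Bochner_Integration.integrable_bound)
    show "integrable lborel (\<lambda>z. 2 * (cmod (f z))\<^sup>2 + 2 * (cmod (g z))\<^sup>2)"
      by (intro Bochner_Integration.integrable_add integrable_mult_right i)
    show "(\<lambda>z. (cmod ((f + g) z))\<^sup>2) \<in> borel_measurable lborel"
      by measurable
  qed (simp add: norm_add_squared_le)
  with d show "f + g \<in> bergman" by (simp add: bergman_iff)
  have "(LINT z|lborel. (cmod ((f + g) z))\<^sup>2) \<le> (LINT z|lborel. 2 * (cmod (f z))\<^sup>2 + 2 * (cmod (g z))\<^sup>2)"
    by (intro integral_mono i3 Bochner_Integration.integrable_add integrable_mult_right i)
      (simp add: norm_add_squared_le)
  also have "\<dots> = 2 * (LINT z|lborel. (cmod (f z))\<^sup>2) + 2 * (LINT z|lborel. (cmod (g z))\<^sup>2)"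
    by (subst Bochner_Integration.integral_add) (intro integrable_mult_right i | simp)+
  finally have "(LINT z|lborel. (cmod ((f + g) z))\<^sup>2) / pi
      \<le> (2 * (LINT z|lborel. (cmod (f z))\<^sup>2) + 2 * (LINT z|lborel. (cmod (g z))\<^sup>2)) / pi"
    by (rule divide_right_mono) simp
  then show "(bergman_norm (f + g))\<^sup>2 \<le> 2 * (bergman_norm f)\<^sup>2 + 2 * (bergman_norm g)\<^sup>2"
    using d by (simp add: bergman_norm_eq add_divide_distrib)
qed

lemma bergman_scale:
  assumes "f \<in> bergman"
  shows "cfun_scale c f \<in> bergman" "bergman_norm (cfun_scale c f) = cmod c * bergman_norm f"
proof -
  have d: "cfun_scale c f \<in> disc_holo"
    using assms by (auto simp: bergman_iff disc_holo_def cfun_scale_def intro!: holomorphic_intros)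
  then show "cfun_scale c f \<in> bergman"
    using assms by (simp add: bergman_iff cfun_scale_def norm_mult power_mult_distrib)
  show "bergman_norm (cfun_scale c f) = cmod c * bergman_norm f"
    using assms bergman_norm_eq[OF d] bergman_norm_eq[of f]
    by (simp add: bergman_iff cfun_scale_def norm_mult power_mult_distrib real_sqrt_mult flip: times_divide_eq_right)
qed

lemma bergman_diff:
  assumes "f \<in> bergman" "g \<in> bergman"
  shows "f - g \<in> bergman"
    and "(bergman_norm (f - g))\<^sup>2 \<le> 2 * (bergman_norm f)\<^sup>2 + 2 * (bergman_norm g)\<^sup>2"
proof -
  have "f - g = f + cfun_scale (-1) g"
    by (auto simp: cfun_scale_def fun_eq_iff)
  then show "f - g \<in> bergman" "(bergman_norm (f - g))\<^sup>2 \<le> 2 * (bergman_norm f)\<^sup>2 + 2 * (bergman_norm g)\<^sup>2"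
    using bergman_add[OF assms(1) bergman_scale(1)[OF assms(2), of "-1"]] bergman_scale(2)[OF assms(2), of "-1"]
    by auto
qed

lemma zero_in_bergman: "0 \<in> bergman"
  by (auto simp: bergman_iff disc_holo_def zero_fun_def)

lemma bergman_norm_nonneg: "bergman_norm f \<ge> 0"
  unfolding bergman_norm_def set_lebesgue_integral_def
  by (intro real_sqrt_ge_zero divide_nonneg_pos Bochner_Integration.integral_nonneg) auto

lemma bounded_op_sum:
  assumes R: "bounded_op bergman bergman_norm R" and g: "\<And>j. g j \<in> bergman"
  shows "(\<lambda>z. \<Sum>j<(n::nat). c j * g j z) \<in> bergman"
    and "R (\<lambda>z. \<Sum>j<n. c j * g j z) = (\<lambda>z. \<Sum>j<n. c j * R (g j) z)"
proof -
  have R_add: "R (f + h) = R f + R h" if "f \<in> bergman" "h \<in> bergman" for f h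
    using R that by (simp add: bounded_op_def)
  have R_scale: "R (cfun_scale c f) = cfun_scale c (R f)" if "f \<in> bergman" for c f
    using R that by (simp add: bounded_op_def)
  show "(\<lambda>z. \<Sum>j<(n::nat). c j * g j z) \<in> bergman"
    and "R (\<lambda>z. \<Sum>j<n. c j * g j z) = (\<lambda>z. \<Sum>j<n. c j * R (g j) z)"
  proof (induction n)
  case 0
  { case 1 show ?case using zero_in_bergman by (simp add: zero_fun_def) }
  { case 2
    have "R 0 = cfun_scale 0 (R 0)"
      using R_scale[OF zero_in_bergman, of 0] by simp
    then show ?case by (simp add: zero_fun_def cfun_scale_def) }
next
  case (Suc n)
  have eq: "(\<lambda>z. \<Sum>j<Suc n. c j * g j z) = (\<lambda>z. \<Sum>j<n. c j * g j z) + cfun_scale (c n) (g n)"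
    by (simp add: fun_eq_iff cfun_scale_def)
  { case 1 show ?case unfolding eq by (intro bergman_add bergman_scale Suc g) }
  { case 2
    have "R ((\<lambda>z. \<Sum>j<n. c j * g j z) + cfun_scale (c n) (g n)) =
        R (\<lambda>z. \<Sum>j<n. c j * g j z) + cfun_scale (c n) (R (g n))"
      by (simp only: R_add[OF Suc.IH(1) bergman_scale(1)[OF g]] R_scale[OF g])
    then show ?case unfolding eq Suc.IH(2) by (simp add: fun_eq_iff cfun_scale_def) }
  qed
qed

text \<open>A value lies below a real supremum only if the set is known to be bounded above;
  boundedness of both operators supplies this.\<close>

lemma op_norm_bergman_ge:
  assumes "bounded_op bergman bergman_norm T" "bounded_op bergman bergman_norm R"
    and f: "f \<in> bergman" "bergman_norm f \<le> 1"
  shows "bergman_norm (T f - R f) \<le> op_norm bergman bergman_norm (T - R)"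
  unfolding op_norm_def
proof (rule cSUP_upper2[where x = f])
  show "bdd_above ((\<lambda>f. bergman_norm ((T - R) f)) ` {f \<in> bergman. bergman_norm f \<le> 1})"
  proof -
    have TR: "T h \<in> bergman" "R h \<in> bergman" if "h \<in> bergman" for h
      using assms(1,2) that by (simp_all add: bounded_op_def)
    obtain K where K: "\<forall>h\<in>bergman. bergman_norm (T h) \<le> K * bergman_norm h"
      using assms(1) by (auto simp: bounded_op_def)
    obtain L where L: "\<forall>h\<in>bergman. bergman_norm (R h) \<le> L * bergman_norm h"
      using assms(2) by (auto simp: bounded_op_def)
    show ?thesis
    proof (rule bdd_aboveI2)
      fix h assume "h \<in> {f \<in> bergman. bergman_norm f \<le> 1}"
      then have h: "h \<in> bergman" "bergman_norm h \<le> 1" by auto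
      have *: "M * bergman_norm h \<le> \<bar>M\<bar>" for M
        using mult_right_mono[OF abs_ge_self[of M] bergman_norm_nonneg[of h]]
          mult_left_mono[OF h(2) abs_ge_zero[of M]] by simp
      have "bergman_norm (T h) \<le> \<bar>K\<bar>" "bergman_norm (R h) \<le> \<bar>L\<bar>"
        using K L h(1) *[of K] *[of L] order_trans by blast+
      from this[THEN power_mono[OF _ bergman_norm_nonneg], of 2] have "(bergman_norm (T h - R h))\<^sup>2 \<le> 2 * K\<^sup>2 + 2 * L\<^sup>2"
        using bergman_diff(2)[OF TR[OF h(1)]] unfolding power2_abs by linarith
      then have "bergman_norm (T h - R h) \<le> sqrt (2 * K\<^sup>2 + 2 * L\<^sup>2)"
        by (rule real_le_rsqrt)
      then show "bergman_norm ((T - R) h) \<le> sqrt (2 * K\<^sup>2 + 2 * L\<^sup>2)"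
        by (simp only: minus_apply)
    qed
  qed
  show "f \<in> {f \<in> bergman. bergman_norm f \<le> 1}"
    using f by simp
  show "bergman_norm (T f - R f) \<le> bergman_norm ((T - R) f)"
    by (simp only: minus_apply order_refl)
qed

section \<open>Schur estimates for nearly diagonal matrices\<close>

lemma schur_bilinear:
  fixes M :: "nat \<Rightarrow> nat \<Rightarrow> real"
  assumes M: "\<And>i j. M i j \<ge> 0" and sym: "\<And>i j. M i j = M j i"
    and row: "\<And>i. i < n \<Longrightarrow> (\<Sum>j<n. M i j) \<le> r"
  shows "(\<Sum>i<n. \<Sum>j<n. M i j * (a i * a j)) \<le> r * (\<Sum>i<n. (a i)\<^sup>2)"
proof -
  have "(\<Sum>i<n. \<Sum>j<n. M i j * (a i * a j)) \<le> (\<Sum>i<n. \<Sum>j<n. M i j * (a i)\<^sup>2 / 2 + M i j * (a j)\<^sup>2 / 2)"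
  proof (intro sum_mono)
    fix i j
    have "a i * a j \<le> (a i)\<^sup>2 / 2 + (a j)\<^sup>2 / 2"
      using sum_squares_bound[of "a i" "a j"] by simp
    from mult_left_mono[OF this M[of i j]]
    show "M i j * (a i * a j) \<le> M i j * (a i)\<^sup>2 / 2 + M i j * (a j)\<^sup>2 / 2"
      by (simp add: algebra_simps)
  qed
  also have "\<dots> = (\<Sum>i<n. \<Sum>j<n. M i j * (a i)\<^sup>2 / 2) + (\<Sum>i<n. \<Sum>j<n. M i j * (a j)\<^sup>2 / 2)"
    by (simp add: sum.distrib)
  also have "(\<Sum>i<n. \<Sum>j<n. M i j * (a j)\<^sup>2 / 2) = (\<Sum>i<n. \<Sum>j<n. M i j * (a i)\<^sup>2 / 2)"
    by (subst sum.swap) (simp add: sym)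
  also have "(\<Sum>i<n. \<Sum>j<n. M i j * (a i)\<^sup>2 / 2) + \<dots> = (\<Sum>i<n. (\<Sum>j<n. M i j) * (a i)\<^sup>2)"
    unfolding sum.distrib[symmetric] sum_distrib_right by (intro sum.cong refl) simp
  also have "\<dots> \<le> (\<Sum>i<n. r * (a i)\<^sup>2)"
    by (intro sum_mono mult_right_mono row) auto
  finally show ?thesis by (simp add: sum_distrib_left)
qed

lemma schur_square:
  fixes M :: "nat \<Rightarrow> nat \<Rightarrow> real"
  assumes M: "\<And>i j. M i j \<ge> 0" and sym: "\<And>i j. M i j = M j i"
    and row: "\<And>i. i < n \<Longrightarrow> (\<Sum>j<n. M i j) \<le> r"
  shows "(\<Sum>i<n. (\<Sum>j<n. M i j * a j)\<^sup>2) \<le> r\<^sup>2 * (\<Sum>i<n. (a i)\<^sup>2)"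
proof (cases "n = 0")
  case False
  then have r: "r \<ge> 0"
    using row[of 0] sum_nonneg[of "{..<n}" "M 0"] M by force
  have "(\<Sum>i<n. (\<Sum>j<n. M i j * a j)\<^sup>2) \<le> (\<Sum>i<n. r * (\<Sum>j<n. M i j * (a j)\<^sup>2))"
  proof (rule sum_mono)
    fix i assume i: "i \<in> {..<n}"
    have "(\<Sum>j<n. M i j * a j)\<^sup>2 = (\<Sum>j<n. sqrt (M i j) * (sqrt (M i j) * a j))\<^sup>2"
      using M by (simp flip: mult.assoc)
    also have "\<dots> \<le> (\<Sum>j<n. (sqrt (M i j))\<^sup>2) * (\<Sum>j<n. (sqrt (M i j) * a j)\<^sup>2)"
      by (rule Cauchy_Schwarz_ineq_sum)
    also have "\<dots> = (\<Sum>j<n. M i j) * (\<Sum>j<n. M i j * (a j)\<^sup>2)"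
      using M by (simp add: power_mult_distrib)
    also have "\<dots> \<le> r * (\<Sum>j<n. M i j * (a j)\<^sup>2)"
      using i M by (intro mult_right_mono row sum_nonneg) auto
    finally show "(\<Sum>j<n. M i j * a j)\<^sup>2 \<le> r * (\<Sum>j<n. M i j * (a j)\<^sup>2)" .
  qed
  also have "\<dots> = r * (\<Sum>j<n. (\<Sum>i<n. M j i) * (a j)\<^sup>2)"
    unfolding sum_distrib_left[symmetric] sum_distrib_right
    by (subst sum.swap, intro arg_cong[where f = "(*) r"] sum.cong refl) (subst sym, rule refl)
  also have "\<dots> \<le> r * (\<Sum>j<n. r * (a j)\<^sup>2)"
    by (intro mult_left_mono sum_mono mult_right_mono row r) auto
  finally show ?thesis by (simp add: sum_distrib_left power2_eq_square mult_ac)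
qed simp

text \<open>With truncated subtraction the exponent is the distance of \<open>i\<close> and
  \<open>j\<close>. The value is the smaller of the two ratios of \<open>scl i\<close> and
  \<open>scl j\<close>.\<close>

definition near_diag :: "nat \<Rightarrow> nat \<Rightarrow> real" where
  "near_diag i j = (1/100) ^ ((i - j) + (j - i))"

lemma near_diag_sym: "near_diag i j = near_diag j i"
  by (simp add: near_diag_def add.commute)

lemma near_diag_nonneg: "near_diag i j \<ge> 0"
  by (simp add: near_diag_def)

lemma near_diag_pos: "near_diag i j > 0"
  by (simp add: near_diag_def)

lemma near_diag_self: "near_diag i i = 1"
  by (simp add: near_diag_def)

text \<open>One geometric series on each side of the diagonal, each with sum at most 1 / 99.\<close>

lemma near_diag_off_row_sum: "(\<Sum>j<n. if j = i then 0 else near_diag i j) \<le> 2 / 99"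
proof -
  have lower: "(\<Sum>j<i. (1/100::real) ^ (i - j)) \<le> 1 / 99" for i
  proof (induction i)
    case (Suc i)
    have "(\<Sum>j<Suc i. (1/100::real) ^ (Suc i - j)) = 1/100 * (\<Sum>j<i. (1/100) ^ (i - j)) + 1/100"
      by (simp add: sum_distrib_left Suc_diff_le)
    then show ?case using Suc by simp
  qed simp
  have geo: "(\<Sum>k<m. (1/100::real) ^ Suc k) = (1 - (1/100) ^ m) / 99" for m
  proof -
    have "(\<Sum>k<m. (1/100::real) ^ Suc k) = 1/100 * (\<Sum>k<m. (1/100) ^ k)"
      by (simp only: power_Suc sum_distrib_left)
    then show ?thesis by (simp add: sum_gp_strict)
  qed
  have upper: "(\<Sum>j\<in>{i<..<i + Suc m}. (1/100::real) ^ (j - i)) \<le> 1 / 99" for m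
  proof -
    have "(\<Sum>j\<in>{i<..<i + Suc m}. (1/100::real) ^ (j - i)) = (\<Sum>k<m. (1/100) ^ Suc k)"
      by (rule sum.reindex_bij_witness[of _ "\<lambda>k. i + Suc k" "\<lambda>j. j - Suc i"])
        (auto simp: Suc_diff_Suc)
    also have "\<dots> \<le> 1 / 99"
      unfolding geo by simp
    finally show ?thesis .
  qed
  have "(\<Sum>j<n. if j = i then 0 else near_diag i j) = (\<Sum>j\<in>{..<n} - {i}. near_diag i j)"
    by (intro sum.mono_neutral_cong_right) auto
  also have "\<dots> \<le> (\<Sum>j\<in>{..<i} \<union> {i<..<i + Suc n}. near_diag i j)"
    by (intro sum_mono2) (auto simp: near_diag_nonneg)
  also have "\<dots> = (\<Sum>j<i. near_diag i j) + (\<Sum>j\<in>{i<..<i + Suc n}. near_diag i j)"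
    by (rule sum.union_disjoint) auto
  also have "\<dots> = (\<Sum>j<i. (1/100) ^ (i - j)) + (\<Sum>j\<in>{i<..<i + Suc n}. (1/100) ^ (j - i))"
    by (intro arg_cong2[of _ _ _ _ "(+)"] sum.cong) (auto simp: near_diag_def)
  also have "\<dots> \<le> 2 / 99"
    using lower[of i] upper[of n] by simp
  finally show ?thesis .
qed

lemma near_diag_row_sum: "(\<Sum>j<n. near_diag i j) \<le> 2"
proof -
  have "(\<Sum>j<n. near_diag i j) = (\<Sum>j<n. if j = i then 0 else near_diag i j) + (\<Sum>j<n. if j = i then 1 else 0)"
    unfolding sum.distrib[symmetric] by (rule sum.cong) (auto simp: near_diag_self)
  also have "\<dots> \<le> 2 / 99 + 1"
    by (intro add_mono near_diag_off_row_sum) auto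
  finally show ?thesis by simp
qed

section \<open>Test kernels at geometric scales\<close>

definition scl :: "nat \<Rightarrow> real" where
  "scl j = (1/100) ^ Suc j"

text \<open>With the third power of the kernel, instead of the reproducing kernel's second power, the
  inner product of \<open>\<bar>bump i\<bar>\<close> and \<open>\<bar>bump j\<bar>\<close> is bounded by the smaller of \<open>scl i / scl j\<close> and
  \<open>scl j / scl i\<close>, up to a constant and without a logarithmic factor.\<close>

definition bump :: "nat \<Rightarrow> complex \<Rightarrow> complex" where
  "bump j w = (if w \<in> ball 0 1 then of_real ((scl j)\<^sup>2) / (1 + of_real (scl j) - w) ^ 3 else 0)"

lemma scl_pos: "scl j > 0"
  by (simp add: scl_def)

lemma scl_diff: "i \<le> j \<Longrightarrow> scl j = (1/100) ^ (j - i) * scl i"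
  by (simp add: scl_def flip: power_add)

lemma scl_near_diag: "i \<le> j \<Longrightarrow> scl j = near_diag i j * scl i"
  by (simp add: near_diag_def scl_diff)

text \<open>The point \<open>1 - w\<close> lies in the right half-plane, so adding \<open>s\<close>
  moves it away from the origin.\<close>

lemma norm_shift_ge:
  assumes "cmod w < 1" "s > 0"
  shows "cmod (1 + of_real s - w) \<ge> s" "cmod (1 + of_real s - w) \<ge> cmod (1 - w)"
proof -
  have re: "Re (1 - w) > 0"
    using assms(1) abs_Re_le_cmod[of w] by simp
  have "s \<le> Re (1 + of_real s - w)"
    using re by simp
  then show "cmod (1 + of_real s - w) \<ge> s"
    using complex_Re_le_cmod order_trans by blast
  have "(cmod (1 - w))\<^sup>2 \<le> (cmod (1 + of_real s - w))\<^sup>2"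
  proof -
    have "(Re (1 - w))\<^sup>2 \<le> (Re (1 + of_real s - w))\<^sup>2"
      using re assms(2) by (intro power_mono) auto
    then show ?thesis by (simp add: cmod_power2)
  qed
  then show "cmod (1 + of_real s - w) \<ge> cmod (1 - w)"
    by (rule power2_le_imp_le) simp
qed

lemma bump_disc_holo: "bump j \<in> disc_holo"
proof -
  have "1 + of_real (scl j) - w \<noteq> 0" if "w \<in> ball 0 1" for w :: complex
    using norm_shift_ge(1)[of w "scl j"] that scl_pos[of j] by auto
  then have "(\<lambda>w. of_real ((scl j)\<^sup>2) / (1 + of_real (scl j) - w) ^ 3) holomorphic_on ball 0 1"
    by (intro holomorphic_intros) auto
  moreover have "(\<lambda>w. of_real ((scl j)\<^sup>2) / (1 + of_real (scl j) - w) ^ 3) holomorphic_on ball 0 1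
     \<longleftrightarrow> bump j holomorphic_on ball 0 1"
    by (rule holomorphic_cong) (auto simp: bump_def)
  ultimately show ?thesis
    by (auto simp: disc_holo_def bump_def)
qed

lemma norm_bump: "cmod w < 1 \<Longrightarrow> cmod (bump j w) = (scl j)\<^sup>2 / cmod (1 + of_real (scl j) - w) ^ 3"
  by (simp add: bump_def norm_divide norm_power)

lemma norm_bump_le:
  assumes "0 < d" "cmod w < 1 \<Longrightarrow> d \<le> cmod (1 + of_real (scl j) - w)"
  shows "cmod (bump j w) \<le> (scl j)\<^sup>2 / d ^ 3"
proof (cases "cmod w < 1")
  case True
  then show ?thesis
    using assms unfolding norm_bump[OF True] by (intro divide_left_mono power_mono mult_pos_pos zero_less_power) auto
next
  case False
  then show ?thesis using assms by (simp add: bump_def)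
qed

lemma norm_bump_le_inverse: "cmod (bump j w) \<le> 1 / scl j"
proof -
  have "cmod (bump j w) \<le> (scl j)\<^sup>2 / (scl j) ^ 3"
    by (rule norm_bump_le) (use scl_pos norm_shift_ge in auto)
  also have "\<dots> = 1 / scl j"
    by (simp add: power2_eq_square power3_eq_cube)
  finally show ?thesis .
qed

text \<open>The kernel is dominated by a step function on the discs of radius \<open>200 * scl m\<close> about 1,
  the annuli between consecutive ones being those on which \<open>|1 - w|\<close> is comparable to \<open>scl m\<close>.\<close>

lemma norm_bump_le_step:
  "cmod (bump j w) \<le> (\<Sum>m\<le>j. (scl j)\<^sup>2 / (scl m) ^ 3 * indicator (ball 1 (200 * scl m)) w)"
proof -
  have single: "cmod (bump j w) \<le> (\<Sum>m\<le>j. (scl j)\<^sup>2 / (scl m) ^ 3 * indicator (ball 1 (200 * scl m)) w)"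
    if m: "m \<le> j" and le: "cmod (bump j w) \<le> (scl j)\<^sup>2 / (scl m) ^ 3" and w: "cmod (1 - w) < 200 * scl m" for m
  proof -
    have "cmod (bump j w) \<le> (scl j)\<^sup>2 / (scl m) ^ 3 * indicator (ball 1 (200 * scl m)) w"
      using le w by (simp add: dist_norm)
    also have "\<dots> \<le> (\<Sum>m\<le>j. (scl j)\<^sup>2 / (scl m) ^ 3 * indicator (ball 1 (200 * scl m)) w)"
      using m scl_pos by (intro member_le_sum) (auto simp: less_imp_le)
    finally show ?thesis .
  qed
  show ?thesis
  proof (cases "cmod w < 1")
    case False
    then have "cmod (bump j w) = 0" by (simp add: bump_def)
    then show ?thesis
      using scl_pos by (auto intro!: sum_nonneg simp: less_imp_le)
  next
    case w: True
    show ?thesis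
    proof (cases "\<exists>m\<le>j. scl m \<le> cmod (1 - w)")
      case False
      then have "cmod (1 - w) < scl j" by auto
      then show ?thesis
        using norm_bump_le_inverse[of j w] scl_pos[of j]
        by (intro single[of j]) (auto simp: power2_eq_square power3_eq_cube)
    next
      case True
      \<comment> \<open>The coarsest scale not exceeding the distance of \<open>w\<close> from 1.
        Either the next coarser scale, 100 times as large, exceeds this distance, or
        \<open>m = 0\<close>; then the distance is less than 2 = \<open>200 * scl 0\<close>, which
        is why the radius factor is 200.\<close>
      define m where "m = (LEAST m. scl m \<le> cmod (1 - w))"
      have m: "scl m \<le> cmod (1 - w)" "m \<le> j"
        using True unfolding m_def by (auto intro: LeastI Least_le order_trans)
      show ?thesis
      proof (rule single[OF m(2)])
        show "cmod (bump j w) \<le> (scl j)\<^sup>2 / scl m ^ 3"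
          using m norm_shift_ge(2)[OF w scl_pos[of j]] scl_pos[of m] by (intro norm_bump_le) auto
        show "cmod (1 - w) < 200 * scl m"
        proof (cases m)
          case 0
          then show ?thesis
            using w norm_triangle_ineq4[of 1 w] by (simp add: scl_def)
        next
          case (Suc k)
          then have "\<not> scl k \<le> cmod (1 - w)"
            using not_less_Least[of k "\<lambda>m. scl m \<le> cmod (1 - w)"] unfolding m_def[symmetric] by simp
          moreover have "scl k = 100 * scl m"
            by (simp add: Suc scl_def)
          ultimately show ?thesis using scl_pos[of m] by simp
        qed
      qed
    qed
  qed
qed

lemma integrable_bounded_on_disc:
  fixes f :: "complex \<Rightarrow> real"
  assumes "f \<in> borel_measurable borel" "\<And>z. \<bar>f z\<bar> \<le> B" "\<And>z. z \<notin> ball 0 1 \<Longrightarrow> f z = 0"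
  shows "integrable lborel f"
proof (rule Bochner_Integration.integrable_bound)
  show "integrable lborel (\<lambda>z. B * indicator (ball (0::complex) 1) z)"
    by (intro integrable_mult_right integrable_real_indicator) (use emeasure_lborel_ball_finite in auto)
  have "\<bar>f z\<bar> \<le> \<bar>B * indicator (ball 0 1) z\<bar>" for z
    using assms(2)[of z] assms(3)[of z] by (cases "z \<in> ball 0 1") auto
  then show "AE z in lborel. norm (f z) \<le> norm (B * indicator (ball 0 1) z)"
    by auto
qed (use assms in simp)

lemma norm_bump_integrable: "integrable lborel (\<lambda>w. cmod (bump j w))"
proof (rule integrable_bounded_on_disc[where B = "1 / scl j"])
  note [measurable] = disc_holo_measurable[OF bump_disc_holo[of j]]
  show "(\<lambda>w. cmod (bump j w)) \<in> borel_measurable borel"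
    by measurable
  show "\<bar>cmod (bump j w)\<bar> \<le> 1 / scl j" for w
    using norm_bump_le_inverse by simp
qed (simp add: bump_def)

lemma norm_bump_prod_integrable: "integrable lborel (\<lambda>w. cmod (bump i w) * cmod (bump j w))"
proof (rule integrable_bounded_on_disc)
  note [measurable] = disc_holo_measurable[OF bump_disc_holo[of i]] disc_holo_measurable[OF bump_disc_holo[of j]]
  show "(\<lambda>w. cmod (bump i w) * cmod (bump j w)) \<in> borel_measurable borel"
    by measurable
  show "\<bar>cmod (bump i w) * cmod (bump j w)\<bar> \<le> 1 / scl i * (1 / scl j)" for w
    unfolding abs_mult using norm_bump_le_inverse scl_pos by (intro mult_mono) (auto simp: less_imp_le)
qed (auto simp: bump_def)

lemma content_disc: "r \<ge> 0 \<Longrightarrow> measure lborel (ball (c::complex) r) = pi * r\<^sup>2"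
  by (simp add: content_ball unit_ball_vol_2)

text \<open>The step of index \<open>m\<close> has area \<open>pi * (200 * scl m)\<^sup>2\<close>,
  so it contributes \<open>40000 * pi * scl j\<close> times \<open>scl j / scl m\<close>. The cube
  in the kernel leaves this decaying ratio, whose sum over \<open>m\<close> is at most 2.\<close>

lemma integral_norm_bump_le: "(LINT w|lborel. cmod (bump j w)) \<le> 80000 * pi * scl j"
proof -
  have ind: "integrable lborel (indicat_real (ball (1::complex) r))" for r
    by (rule integrable_real_indicator) (use emeasure_lborel_ball_finite in auto)
  have "(LINT w|lborel. cmod (bump j w))
      \<le> (LINT w|lborel. (\<Sum>m\<le>j. (scl j)\<^sup>2 / (scl m) ^ 3 * indicator (ball (1::complex) (200 * scl m)) w))"
    by (intro integral_mono norm_bump_integrable norm_bump_le_step Bochner_Integration.integrable_sum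
        integrable_mult_right ind)
  also have "\<dots> = (\<Sum>m\<le>j. (scl j)\<^sup>2 / (scl m) ^ 3 * (pi * (200 * scl m)\<^sup>2))"
    using scl_pos by (subst Bochner_Integration.integral_sum)
      (auto intro!: integrable_mult_right ind sum.cong simp: content_disc less_imp_le)
  also have "\<dots> = (\<Sum>m\<le>j. 40000 * pi * scl j * near_diag j m)"
  proof (rule sum.cong)
    fix m assume "m \<in> {..j}"
    then have "scl j / scl m = near_diag j m"
      using scl_near_diag[of m j] scl_pos[of m] by (simp add: near_diag_sym)
    moreover have "(scl j)\<^sup>2 / (scl m) ^ 3 * (pi * (200 * scl m)\<^sup>2) = 40000 * pi * scl j * (scl j / scl m)"
      using scl_pos[of m] by (simp add: power2_eq_square power3_eq_cube)
    ultimately show "(scl j)\<^sup>2 / (scl m) ^ 3 * (pi * (200 * scl m)\<^sup>2) = 40000 * pi * scl j * near_diag j m"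
      by simp
  qed simp
  also have "\<dots> = 40000 * pi * scl j * (\<Sum>m<Suc j. near_diag j m)"
    by (simp only: sum_distrib_left lessThan_Suc_atMost)
  also have "\<dots> \<le> 40000 * pi * scl j * 2"
    using scl_pos[of j] by (intro mult_left_mono near_diag_row_sum) auto
  finally show ?thesis by simp
qed

text \<open>The wider kernel is replaced by its supremum and the narrower one is integrated; the
  ratio of their scales remains.\<close>

lemma integral_norm_bump_prod_le:
  "(LINT w|lborel. cmod (bump i w) * cmod (bump j w)) \<le> 80000 * pi * near_diag i j"
proof -
  have *: "(LINT w|lborel. cmod (bump i w) * cmod (bump j w)) \<le> 80000 * pi * near_diag i j" if "i \<le> j" for i j
  proof -
    have "(LINT w|lborel. cmod (bump i w) * cmod (bump j w)) \<le> (LINT w|lborel. 1 / scl i * cmod (bump j w))"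
      by (intro integral_mono norm_bump_prod_integrable integrable_mult_right norm_bump_integrable
          mult_right_mono norm_bump_le_inverse) auto
    also have "\<dots> = 1 / scl i * (LINT w|lborel. cmod (bump j w))"
      by simp
    also have "\<dots> \<le> 1 / scl i * (80000 * pi * scl j)"
      using scl_pos[of i] by (intro mult_left_mono integral_norm_bump_le) auto
    also have "\<dots> = 80000 * pi * near_diag i j"
      using scl_near_diag[OF that] scl_pos[of i] by simp
    finally show ?thesis .
  qed
  show ?thesis
    using *[of i j] *[of j i] by (cases "i \<le> j") (auto simp: near_diag_sym mult.commute)
qed

lemma bump_bergman: "bump j \<in> bergman"
  using norm_bump_prod_integrable[of j j] bump_disc_holo by (simp add: bergman_iff power2_eq_square)

text \<open>The upper half of almost orthogonality: the Gram matrix of absolute values is nearly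
  diagonal, so the Schur bound applies. The row sum 2 doubles the constant 80000, and
  \<open>pi\<close> cancels against the normalised area.\<close>

lemma bergman_norm_bump_sum_le:
  "(bergman_norm (\<lambda>w. \<Sum>j<n. c j * bump j w))\<^sup>2 \<le> 160000 * (\<Sum>j<n. (cmod (c j))\<^sup>2)"
proof -
  define f where "f w = (\<Sum>j<n. c j * bump j w)" for w
  have f_eq: "f = (\<lambda>w. \<Sum>j<n. c j * bump j w)" by (simp add: f_def fun_eq_iff)
  have f: "f \<in> disc_holo" "integrable lborel (\<lambda>w. (cmod (f w))\<^sup>2)"
  proof -
    have "f \<in> disc_holo"
      using bump_disc_holo unfolding f_eq disc_holo_def by (auto intro!: holomorphic_intros)
    moreover have "integrable lborel (\<lambda>w. (cmod (f w))\<^sup>2)"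
    proof (rule integrable_bounded_on_disc)
      note [measurable] = disc_holo_measurable[OF \<open>f \<in> disc_holo\<close>]
      show "(\<lambda>w. (cmod (f w))\<^sup>2) \<in> borel_measurable borel" by measurable
      fix w
      have "cmod (f w) \<le> (\<Sum>j<n. cmod (c j) * (1 / scl j))"
        unfolding f_def by (intro sum_norm_le) (simp only: norm_mult mult_left_mono norm_bump_le_inverse norm_ge_zero)
      then show "\<bar>(cmod (f w))\<^sup>2\<bar> \<le> (\<Sum>j<n. cmod (c j) * (1 / scl j))\<^sup>2"
        by (simp add: power_mono)
    qed (use \<open>f \<in> disc_holo\<close> in \<open>simp add: disc_holo_def\<close>)
    ultimately show "f \<in> disc_holo" "integrable lborel (\<lambda>w. (cmod (f w))\<^sup>2)" by auto
  qed
  have "(LINT w|lborel. (cmod (f w))\<^sup>2)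
      \<le> (LINT w|lborel. (\<Sum>i<n. \<Sum>j<n. cmod (c i) * cmod (c j) * (cmod (bump i w) * cmod (bump j w))))"
  proof (intro integral_mono f Bochner_Integration.integrable_sum integrable_mult_right norm_bump_prod_integrable)
    fix w
    have "cmod (f w) \<le> (\<Sum>j<n. cmod (c j) * cmod (bump j w))"
      unfolding f_def by (intro sum_norm_le) (simp add: norm_mult)
    then have "(cmod (f w))\<^sup>2 \<le> (\<Sum>j<n. cmod (c j) * cmod (bump j w))\<^sup>2"
      by (intro power_mono) auto
    also have "\<dots> = (\<Sum>i<n. \<Sum>j<n. cmod (c i) * cmod (c j) * (cmod (bump i w) * cmod (bump j w)))"
      by (simp add: power2_eq_square sum_product mult_ac)
    finally show "(cmod (f w))\<^sup>2 \<le> \<dots>" .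
  qed
  also have "\<dots> = (\<Sum>i<n. \<Sum>j<n. cmod (c i) * cmod (c j) * (LINT w|lborel. cmod (bump i w) * cmod (bump j w)))"
    by (simp add: norm_bump_prod_integrable)
  also have "\<dots> \<le> (\<Sum>i<n. \<Sum>j<n. cmod (c i) * cmod (c j) * (80000 * pi * near_diag i j))"
    by (intro sum_mono mult_left_mono integral_norm_bump_prod_le) auto
  also have "\<dots> = 80000 * pi * (\<Sum>i<n. \<Sum>j<n. near_diag i j * (cmod (c i) * cmod (c j)))"
    unfolding sum_distrib_left by (intro sum.cong refl) (simp add: mult_ac)
  also have "\<dots> \<le> 80000 * pi * (2 * (\<Sum>i<n. (cmod (c i))\<^sup>2))"
    by (intro mult_left_mono schur_bilinear near_diag_nonneg near_diag_sym near_diag_row_sum) auto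
  finally have "(LINT w|lborel. (cmod (f w))\<^sup>2) / pi \<le> 160000 * (\<Sum>j<n. (cmod (c j))\<^sup>2)"
    by (simp add: field_simps)
  moreover have "(bergman_norm f)\<^sup>2 = (LINT w|lborel. (cmod (f w))\<^sup>2) / pi"
    using bergman_norm_eq[OF f(1)] by simp
  ultimately show ?thesis by (simp add: f_eq)
qed

section \<open>Lower bounds after composition\<close>

text \<open>The base of the cube in the denominator has modulus at most
  \<open>2 * scl j + scl j / 3\<close>, and 27 / 343 is the cube of 3 / 7.\<close>

lemma bump_at_own_scale:
  assumes w: "cmod w < 1" "cmod (w - of_real (1 - scl j)) \<le> scl j / 3"
  shows "cmod (bump j w) \<ge> 27 / 343 / scl j"
proof -
  have "cmod (1 + of_real (scl j) - w) = cmod (2 * of_real (scl j) - (w - of_real (1 - scl j)))"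
    by (simp add: algebra_simps)
  also have "\<dots> \<le> cmod (2 * of_real (scl j)) + cmod (w - of_real (1 - scl j))"
    by (rule norm_triangle_ineq4)
  also have "\<dots> \<le> 7 / 3 * scl j"
    using w(2) scl_pos[of j] by (simp add: norm_mult)
  finally have "cmod (1 + of_real (scl j) - w) ^ 3 \<le> (7 / 3 * scl j) ^ 3"
    by (intro power_mono) auto
  moreover have "cmod (1 + of_real (scl j) - w) > 0"
    using norm_shift_ge(1)[OF w(1) scl_pos[of j]] scl_pos[of j] by linarith
  ultimately have "(scl j)\<^sup>2 / (7 / 3 * scl j) ^ 3 \<le> cmod (bump j w)"
    unfolding norm_bump[OF w(1)] using scl_pos[of j] by (intro divide_left_mono) auto
  then show ?thesis
    using scl_pos[of j] by (simp add: power_mult_distrib power2_eq_square power3_eq_cube field_simps)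
qed

text \<open>A wider kernel is bounded by its supremum \<open>1 / scl i\<close>. For a narrower one
  the denominator is at least \<open>2 / 3 * scl j\<close>, which gives the square of the scale
  ratio \<open>q\<close> with factor 27 / 8; one of the two factors \<open>q\<close> absorbs
  it.\<close>

lemma bump_at_other_scale:
  assumes ij: "i \<noteq> j" and w: "cmod w < 1" "cmod (w - of_real (1 - scl j)) \<le> scl j / 3"
  shows "cmod (bump i w) \<le> near_diag j i / scl j"
proof (cases "i < j")
  case True
  then have "1 / scl i = near_diag j i / scl j"
    using scl_near_diag[of i j] scl_pos[of i] near_diag_pos[of j i] by (simp add: near_diag_sym[of i j])
  then show ?thesis using norm_bump_le_inverse[of i w] by simp
next
  case False
  with ij have "j < i" by simp
  define q where "q = near_diag j i"
  have si: "scl i = q * scl j"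
    using scl_near_diag[of j i] \<open>j < i\<close> by (simp add: q_def)
  have q: "0 < q" "q \<le> 1 / 100"
  proof -
    show "0 < q" by (simp add: q_def near_diag_def)
    have "q = (1/100) ^ (i - j)" using \<open>j < i\<close> by (simp add: q_def near_diag_def)
    also have "\<dots> \<le> (1/100) ^ 1" using \<open>j < i\<close> by (intro power_decreasing) auto
    finally show "q \<le> 1 / 100" by simp
  qed
  have "Re (1 + of_real (scl i) - w) \<ge> 2 / 3 * scl j"
    using w(2) scl_pos[of i] abs_Re_le_cmod[of "w - of_real (1 - scl j)"] by simp
  then have "cmod (1 + of_real (scl i) - w) \<ge> 2 / 3 * scl j"
    using complex_Re_le_cmod order_trans by blast
  then have "cmod (bump i w) \<le> (scl i)\<^sup>2 / (2 / 3 * scl j) ^ 3"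
    using scl_pos[of j] by (intro norm_bump_le) auto
  also have "\<dots> = (27 / 8 * q) * q / scl j"
    using scl_pos[of j] by (simp add: si power_mult_distrib power2_eq_square power3_eq_cube field_simps)
  also have "\<dots> \<le> 1 * q / scl j"
    using q scl_pos[of j] by (intro divide_right_mono mult_right_mono) auto
  finally show ?thesis by (simp add: q_def)
qed

lemma sum_disjoint_indicator_le:
  fixes m :: "nat \<Rightarrow> real"
  assumes disj: "\<And>i j. i < n \<Longrightarrow> j < n \<Longrightarrow> i \<noteq> j \<Longrightarrow> Q i \<inter> Q j = {}"
    and le: "\<And>j. j < n \<Longrightarrow> z \<in> Q j \<Longrightarrow> m j \<le> y" and "0 \<le> y"
  shows "(\<Sum>j<n. m j * indicator (Q j) z) \<le> y"
proof (cases "\<exists>j<n. z \<in> Q j")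
  case True
  then obtain j where j: "j < n" "z \<in> Q j" by blast
  have "(\<Sum>i<n. m i * indicator (Q i) z) = (\<Sum>i<n. if i = j then m j else 0)"
    using j disj by (intro sum.cong) (auto simp: indicator_def)
  also have "\<dots> = m j" using j by simp
  finally show ?thesis using le j by simp
next
  case False
  then have "(\<Sum>j<n. m j * indicator (Q j) z) = 0"
    by (intro sum.neutral) auto
  then show ?thesis using \<open>0 \<le> y\<close> by simp
qed

text \<open>Here \<open>a\<close> is the contribution of the kernel at its own scale and
  \<open>b\<close> the interference of the others. The bound is kept quadratic, and may be negative
  for a single \<open>j\<close>, because \<open>b\<close> is controlled only after summation over
  \<open>j\<close>.\<close>

lemma bump_sum_lower:
  fixes c :: "nat \<Rightarrow> complex"
  assumes j: "j < n" and w: "cmod w < 1" "cmod (w - of_real (1 - scl j)) \<le> scl j / 3"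
  defines "a \<equiv> 27 / 343 * cmod (c j)"
    and "b \<equiv> (\<Sum>i<n. (if i = j then 0 else near_diag j i) * cmod (c i))"
  shows "(a\<^sup>2 / 2 - b\<^sup>2) / (scl j)\<^sup>2 \<le> (cmod (\<Sum>i<n. c i * bump i w))\<^sup>2"
proof -
  define x where "x = cmod (\<Sum>i<n. c i * bump i w)"
  define r where "r = (\<Sum>i\<in>{..<n} - {j}. c i * bump i w)"
  have "(\<Sum>i<n. c i * bump i w) = c j * bump j w + r"
    using j by (simp add: r_def sum.remove)
  then have "cmod (c j * bump j w) \<le> x + cmod r"
    using norm_triangle_ineq4[of "c j * bump j w + r" r] by (simp add: x_def)
  moreover have "a / scl j \<le> cmod (c j * bump j w)"
    using mult_left_mono[OF bump_at_own_scale[OF w] norm_ge_zero[of "c j"]]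
    by (simp add: a_def norm_mult)
  moreover have "cmod r \<le> b / scl j"
  proof -
    have "cmod r \<le> (\<Sum>i\<in>{..<n} - {j}. cmod (c i) * (near_diag j i / scl j))"
      unfolding r_def using bump_at_other_scale[OF _ w]
      by (intro sum_norm_le) (auto simp only: norm_mult intro!: mult_left_mono norm_ge_zero)
    also have "\<dots> = b / scl j"
      unfolding b_def sum_divide_distrib by (intro sum.mono_neutral_cong_left) auto
    finally show ?thesis .
  qed
  ultimately have "a / scl j \<le> x + b / scl j" by linarith
  moreover have "a \<ge> 0" by (simp add: a_def)
  ultimately have "(a / scl j)\<^sup>2 \<le> (x + b / scl j)\<^sup>2"
    using scl_pos[of j] by (intro power_mono) auto
  also have "\<dots> \<le> 2 * x\<^sup>2 + 2 * (b / scl j)\<^sup>2"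
    using sum_squares_bound[of x "b / scl j"] unfolding power2_sum by linarith
  finally show ?thesis
    by (simp add: x_def power_divide diff_divide_distrib)
qed

text \<open>The pointwise bound is integrated over the discs about \<open>x j\<close>, which needs
  no change of variables. The normalised area of a disc against the squared height of its kernel
  gives the weight \<open>(r j / scl j)\<^sup>2\<close>, at least
  \<open>\<delta>\<^sup>2\<close>.\<close>

lemma comp_op_bump_sum_lower:
  fixes x :: "nat \<Rightarrow> complex"
  assumes holo: "\<phi> holomorphic_on ball 0 1" "\<phi> \<in> ball 0 1 \<rightarrow> ball 0 1"
    and bdd: "bounded_op bergman bergman_norm (comp_op \<phi>)"
    and Q: "\<And>j. j < n \<Longrightarrow> ball (x j) (r j) \<subseteq> ball 0 1"
    and \<phi>: "\<And>j z. j < n \<Longrightarrow> z \<in> ball (x j) (r j) \<Longrightarrow> cmod (\<phi> z - of_real (1 - scl j)) \<le> scl j / 3"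
    and \<delta>: "\<delta> \<ge> 0" "\<And>j. j < n \<Longrightarrow> \<delta> * scl j \<le> r j"
  shows "\<delta>\<^sup>2 / 400 * (\<Sum>j<n. (cmod (c j))\<^sup>2) \<le> (bergman_norm (comp_op \<phi> (\<lambda>w. \<Sum>j<n. c j * bump j w)))\<^sup>2"
proof -
  define f where "f = (\<lambda>w. \<Sum>j<n. c j * bump j w)"
  define b where "b j = (\<Sum>i<n. (if i = j then 0 else near_diag j i) * cmod (c i))" for j
  define m where "m j = ((27 / 343 * cmod (c j))\<^sup>2 / 2 - (b j)\<^sup>2)" for j
  \<comment> \<open>The truncation at 0 keeps the weight estimate valid where \<open>m j\<close> is
    negative, and makes the step function a lower bound for a square.\<close>
  define M where "M j = max 0 (m j)" for j
  define T where "T = comp_op \<phi> f"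
  have "f \<in> bergman"
    unfolding f_def by (rule bounded_op_sum[OF bdd bump_bergman])
  then have T: "T \<in> bergman"
    using bdd by (simp add: T_def bounded_op_def)
  then have T': "T \<in> disc_holo" "integrable lborel (\<lambda>z. (cmod (T z))\<^sup>2)"
    by (auto simp: bergman_iff)
  have r: "r j \<ge> 0" if "j < n" for j
    using \<delta>(2)[OF that] \<delta>(1) scl_pos[of j] by (meson less_imp_le mult_nonneg_nonneg order_trans)
  have lower: "M j / (scl j)\<^sup>2 \<le> (cmod (T z))\<^sup>2" if "j < n" "z \<in> ball (x j) (r j)" for j z
  proof -
    have z: "z \<in> ball 0 1" using Q that by blast
    then have "cmod (\<phi> z) < 1" using holo(2) by (auto simp: Pi_iff)
    from bump_sum_lower[OF that(1) this \<phi>[OF that]]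
    have "m j / (scl j)\<^sup>2 \<le> (cmod (f (\<phi> z)))\<^sup>2"
      by (simp add: m_def b_def f_def)
    then show ?thesis
      using z by (simp add: M_def T_def comp_op_def max_def)
  qed
  \<comment> \<open>A common point would have its image near both 1 - \<open>scl i\<close> and 1 -
    \<open>scl j\<close>, which are too far apart.\<close>
  have disj: "ball (x i) (r i) \<inter> ball (x j) (r j) = {}" if "i < n" "j < n" "i \<noteq> j" for i j
  proof -
    have *: False if "i < n" "j < n" "i < j" "z \<in> ball (x i) (r i)" "z \<in> ball (x j) (r j)" for i j z
    proof -
      have "scl j = (1/100) ^ (j - i) * scl i"
        using that by (simp add: scl_diff)
      also have "\<dots> \<le> (1/100) ^ 1 * scl i"
        using that scl_pos[of i] by (intro mult_right_mono power_decreasing) auto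
      finally have "scl j \<le> scl i / 100" by simp
      moreover have "\<bar>Re (\<phi> z) - (1 - scl i)\<bar> \<le> scl i / 3" "\<bar>Re (\<phi> z) - (1 - scl j)\<bar> \<le> scl j / 3"
        using \<phi>[OF that(1,4)] \<phi>[OF that(2,5)] abs_Re_le_cmod[of "\<phi> z - of_real (1 - scl i)"]
          abs_Re_le_cmod[of "\<phi> z - of_real (1 - scl j)"] by auto
      ultimately show False
        using scl_pos[of i] by linarith
    qed
    show ?thesis
      using *[of i j] *[of j i] that by (metis disjoint_iff linorder_neqE_nat)
  qed
  have ind: "integrable lborel (indicat_real (ball (z::complex) s))" for z s
    by (rule integrable_real_indicator) (use emeasure_lborel_ball_finite in auto)
  have b_sum: "(\<Sum>j<n. (b j)\<^sup>2) \<le> (2 / 99)\<^sup>2 * (\<Sum>j<n. (cmod (c j))\<^sup>2)"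
    unfolding b_def
  proof (rule schur_square)
    show "(\<Sum>j<n. if j = i then 0 else near_diag i j) \<le> 2 / 99" for i
      by (rule near_diag_off_row_sum)
  qed (auto simp: near_diag_nonneg near_diag_sym)
  have "\<delta>\<^sup>2 * ((\<Sum>j<n. (cmod (c j))\<^sup>2) / 400) \<le> \<delta>\<^sup>2 * (\<Sum>j<n. m j)"
  proof (rule mult_left_mono)
    have "(\<Sum>j<n. m j) = (27 / 343)\<^sup>2 / 2 * (\<Sum>j<n. (cmod (c j))\<^sup>2) - (\<Sum>j<n. (b j)\<^sup>2)"
      by (simp only: m_def sum_subtractf sum_distrib_left) (simp add: power_mult_distrib power_divide)
    then have "(\<Sum>j<n. m j) \<ge> ((27 / 343)\<^sup>2 / 2 - (2 / 99)\<^sup>2) * (\<Sum>j<n. (cmod (c j))\<^sup>2)"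
      using b_sum by (simp add: left_diff_distrib)
    \<comment> \<open>The numerical margin of the construction: the left factor is about 0.00269 and
      1 / 400 is 0.0025.\<close>
    moreover have "((27 / 343)\<^sup>2 / 2 - (2 / 99)\<^sup>2) * (\<Sum>j<n. (cmod (c j))\<^sup>2) \<ge> 1 / 400 * (\<Sum>j<n. (cmod (c j))\<^sup>2)"
      by (intro mult_right_mono sum_nonneg) (auto simp: power2_eq_square)
    ultimately show "(\<Sum>j<n. (cmod (c j))\<^sup>2) / 400 \<le> (\<Sum>j<n. m j)" by simp
  qed simp
  also have "\<dots> \<le> (\<Sum>j<n. M j / (scl j)\<^sup>2 * (r j)\<^sup>2)"
    unfolding sum_distrib_left
  proof (rule sum_mono)
    fix j assume "j \<in> {..<n}"
    then have "\<delta> \<le> r j / scl j"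
      using \<delta>(2)[of j] scl_pos[of j] by (simp add: field_simps)
    then have "\<delta>\<^sup>2 \<le> (r j / scl j)\<^sup>2"
      using \<delta>(1) by (rule power_mono)
    then have "\<delta>\<^sup>2 * M j \<le> (r j / scl j)\<^sup>2 * M j"
      by (rule mult_right_mono) (simp add: M_def)
    moreover have "\<delta>\<^sup>2 * m j \<le> \<delta>\<^sup>2 * M j"
      by (rule mult_left_mono) (auto simp: M_def)
    ultimately show "\<delta>\<^sup>2 * m j \<le> M j / (scl j)\<^sup>2 * (r j)\<^sup>2"
      by (simp add: power_divide mult_ac)
  qed
  also have "\<dots> = (LINT z|lborel. (\<Sum>j<n. M j / (scl j)\<^sup>2 * indicator (ball (x j) (r j)) z)) / pi"
  proof -
    have "(LINT z|lborel. (\<Sum>j<n. M j / (scl j)\<^sup>2 * indicator (ball (x j) (r j)) z))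
        = (\<Sum>j<n. M j / (scl j)\<^sup>2 * (pi * (r j)\<^sup>2))"
      using r by (subst Bochner_Integration.integral_sum)
        (auto intro!: integrable_mult_right ind sum.cong simp: content_disc)
    then show ?thesis by (simp add: sum_divide_distrib)
  qed
  also have "\<dots> \<le> (LINT z|lborel. (cmod (T z))\<^sup>2) / pi"
    by (intro divide_right_mono integral_mono T' Bochner_Integration.integrable_sum integrable_mult_right ind
        sum_disjoint_indicator_le disj lower) auto
  also have "\<dots> = (bergman_norm T)\<^sup>2"
    by (simp add: bergman_norm_eq[OF T'(1)])
  finally show ?thesis by (simp add: T_def f_def)
qed

text \<open>An operator of rank less than \<open>n\<close> kills a nontrivial combination
  \<open>f\<close> of the \<open>n\<close> kernels. On \<open>f\<close> the difference of the
  operators is just the composition operator, which is bounded below there.\<close>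

lemma approx_num_comp_op_lower:
  fixes x :: "nat \<Rightarrow> complex"
  assumes holo: "\<phi> holomorphic_on ball 0 1" "\<phi> \<in> ball 0 1 \<rightarrow> ball 0 1"
    and bdd: "bounded_op bergman bergman_norm (comp_op \<phi>)"
    and Q: "\<And>j. j < n \<Longrightarrow> ball (x j) (r j) \<subseteq> ball 0 1"
    and \<phi>: "\<And>j z. j < n \<Longrightarrow> z \<in> ball (x j) (r j) \<Longrightarrow> cmod (\<phi> z - of_real (1 - scl j)) \<le> scl j / 3"
    and \<delta>: "\<delta> \<ge> 0" "\<And>j. j < n \<Longrightarrow> \<delta> * scl j \<le> r j" and n: "n > 0"
  shows "\<delta> / 8000 \<le> approx_num bergman bergman_norm (comp_op \<phi>) n"
  unfolding approx_num_def
proof (rule cINF_greatest)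
  \<comment> \<open>The zero operator shows that the infimum is over a nonempty set.\<close>
  have "bounded_op bergman bergman_norm (\<lambda>f. 0)"
    unfolding bounded_op_def
  proof (intro conjI exI)
    show "\<forall>f\<in>bergman. bergman_norm 0 \<le> 0 * bergman_norm f"
      by (simp add: bergman_norm_def zero_fun_def)
  qed (auto simp: zero_in_bergman)
  moreover have "rank_less bergman (\<lambda>f. 0) n"
    unfolding rank_less_def using n by (intro exI[of _ "{}"]) auto
  ultimately show "{R. bounded_op bergman bergman_norm R \<and> rank_less bergman R n} \<noteq> {}" by blast
next
  fix R assume "R \<in> {R. bounded_op bergman bergman_norm R \<and> rank_less bergman R n}"
  then have R: "bounded_op bergman bergman_norm R" and "rank_less bergman R n" by auto
  then obtain B where B: "finite B" "card B < n" "R ` bergman \<subseteq> cfun.span B"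
    by (auto simp: rank_less_def)
  obtain c' where c': "\<exists>j<n. c' j \<noteq> 0" "\<And>z. (\<Sum>j<n. c' j * R (bump j) z) = 0"
    using nontrivial_relation_in_span[OF B(1,2), of "\<lambda>j. R (bump j)"] B(3) bump_bergman by blast
  define s where "s = (\<Sum>j<n. (cmod (c' j))\<^sup>2)"
  have s: "s > 0"
  proof -
    obtain j where j: "j < n" "c' j \<noteq> 0" using c'(1) by blast
    then have "0 < (cmod (c' j))\<^sup>2" by simp
    also have "\<dots> \<le> s" unfolding s_def using j by (intro member_le_sum) auto
    finally show ?thesis .
  qed
  \<comment> \<open>Normalised so that the upper bound with constant 160000 gives \<open>f\<close>
    norm at most 1. The lower bound then becomes \<delta> / 8000, since 400 times 160000 is the
    square of 8000.\<close>
  define c where "c j = c' j / of_real (400 * sqrt s)" for j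
  have c_sum: "(\<Sum>j<n. (cmod (c j))\<^sup>2) = 1 / 160000"
  proof -
    have "(\<Sum>j<n. (cmod (c j))\<^sup>2) = (\<Sum>j<n. (cmod (c' j))\<^sup>2) / (400 * sqrt s)\<^sup>2"
      unfolding sum_divide_distrib c_def using s by (simp add: norm_divide power_divide)
    then show ?thesis using s by (simp add: s_def[symmetric] power_mult_distrib)
  qed
  define f where "f = (\<lambda>w. \<Sum>j<n. c j * bump j w)"
  have f: "f \<in> bergman"
    unfolding f_def by (rule bounded_op_sum[OF bdd bump_bergman])
  have "R f = 0"
  proof -
    have "R f = (\<lambda>z. \<Sum>j<n. c j * R (bump j) z)"
      unfolding f_def by (rule bounded_op_sum[OF R bump_bergman])
    moreover have "(\<Sum>j<n. c j * R (bump j) z) = (\<Sum>j<n. c' j * R (bump j) z) / of_real (400 * sqrt s)" for z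
      unfolding sum_divide_distrib c_def by simp
    ultimately show ?thesis using c'(2) by (simp add: fun_eq_iff)
  qed
  have "(bergman_norm f)\<^sup>2 \<le> 1\<^sup>2"
    using bergman_norm_bump_sum_le[where n = n and c = c] c_sum by (simp add: f_def)
  then have "bergman_norm f \<le> 1"
    by (rule power2_le_imp_le) simp
  from op_norm_bergman_ge[OF bdd R f this] \<open>R f = 0\<close>
  have le: "bergman_norm (comp_op \<phi> f) \<le> op_norm bergman bergman_norm (comp_op \<phi> - R)"
    by simp
  have "\<delta>\<^sup>2 / 400 * (\<Sum>j<n. (cmod (c j))\<^sup>2) \<le> (bergman_norm (comp_op \<phi> f))\<^sup>2"
    unfolding f_def by (rule comp_op_bump_sum_lower[OF holo bdd Q \<phi> \<delta>])
  then have "(\<delta> / 8000)\<^sup>2 \<le> (bergman_norm (comp_op \<phi> f))\<^sup>2"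
    unfolding c_sum by (simp add: power_divide)
  then have "\<delta> / 8000 \<le> bergman_norm (comp_op \<phi> f)"
    by (rule power2_le_imp_le) (rule bergman_norm_nonneg)
  with le show "\<delta> / 8000 \<le> op_norm bergman bergman_norm (comp_op \<phi> - R)"
    by simp
qed

section \<open>The symbol\<close>

definition symbol :: "complex \<Rightarrow> complex" where
  "symbol = eval_fps (Abs_fps (\<lambda>k. of_real (fps_nth symbol_fps k)))"

lemma symbol_radius: "fps_conv_radius (Abs_fps (\<lambda>k. complex_of_real (fps_nth symbol_fps k))) \<ge> 1"
  using symbol_fps_nonneg symbol_fps_le_1 by (intro bounded_coeff_conv_radius[of _ 1]) auto

lemma symbol_has_fps_expansion:
  "symbol has_fps_expansion Abs_fps (\<lambda>k. of_real (fps_nth symbol_fps k))"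
  unfolding symbol_def
  by (rule eval_fps_has_fps_expansion) (rule less_le_trans[OF _ symbol_radius], simp)

lemma symbol_holomorphic: "symbol holomorphic_on ball 0 1"
  unfolding symbol_def
proof (rule holomorphic_on_eval_fps)
  show "ball (0::complex) 1 \<subseteq> eball 0 (fps_conv_radius (Abs_fps (\<lambda>k. complex_of_real (fps_nth symbol_fps k))))"
  proof
    fix z :: complex assume "z \<in> ball 0 1"
    then have "ereal (dist 0 z) < 1" by simp
    then show "z \<in> eball 0 (fps_conv_radius (Abs_fps (\<lambda>k. complex_of_real (fps_nth symbol_fps k))))"
      unfolding in_eball_iff using symbol_radius by (rule less_le_trans)
  qed
qed

lemma symbol_sums:
  assumes "cmod z < 1"
  shows "(\<lambda>k. of_real (fps_nth symbol_fps k) * z ^ k) sums symbol z"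
proof -
  have "summable (\<lambda>k. fps_nth (Abs_fps (\<lambda>k. complex_of_real (fps_nth symbol_fps k))) k * z ^ k)"
    using assms by (intro summable_fps less_le_trans[OF _ symbol_radius]) simp
  then show ?thesis
    by (simp add: symbol_def eval_fps_def summable_sums)
qed

lemma symbol_fps_sums:
  assumes "\<bar>x\<bar> < 1"
  shows "(\<lambda>k. fps_nth symbol_fps k * x ^ k) sums eval_fps symbol_fps x"
  unfolding eval_fps_def
  using assms by (intro summable_sums summable_fps less_le_trans[OF _ symbol_fps_radius]) simp

lemma symbol_of_real: "\<bar>x\<bar> < 1 \<Longrightarrow> symbol (of_real x) = of_real (eval_fps symbol_fps x)"
  using sums_of_real[OF symbol_fps_sums[of x], where 'a = complex] symbol_sums[of "of_real x"]
  by (auto intro: sums_unique2)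

text \<open>The estimate of Schwarz's lemma, here termwise: the constant term vanishes and the
  nonnegative coefficients sum to at most 1.\<close>

lemma norm_symbol_le:
  assumes "cmod z < 1" shows "cmod (symbol z) \<le> cmod z"
proof -
  have le: "cmod (of_real (fps_nth symbol_fps k) * z ^ k) \<le> fps_nth symbol_fps k * cmod z" for k
  proof (cases k)
    case 0
    then show ?thesis by (simp add: symbol_fps_0)
  next
    case (Suc m)
    have "cmod z ^ Suc m \<le> cmod z ^ 1"
      using assms by (intro power_decreasing) auto
    then show ?thesis
      using symbol_fps_nonneg[of k] by (auto simp: norm_mult norm_power Suc intro!: mult_left_mono)
  qed
  have s: "summable (\<lambda>k. fps_nth symbol_fps k * cmod z)"
    by (rule summable_mult2[OF symbol_fps_summable])
  have "cmod (symbol z) = cmod (\<Sum>k. of_real (fps_nth symbol_fps k) * z ^ k)"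
    using symbol_sums[OF assms] by (simp add: sums_iff)
  also have "\<dots> \<le> (\<Sum>k. fps_nth symbol_fps k * cmod z)"
    by (rule norm_suminf_le[OF le s])
  also have "\<dots> = (\<Sum>k. fps_nth symbol_fps k) * cmod z"
    by (rule suminf_mult2[OF symbol_fps_summable, symmetric])
  also have "\<dots> \<le> 1 * cmod z"
    by (intro mult_right_mono symbol_fps_suminf) auto
  finally show ?thesis by simp
qed

lemma symbol_maps: "symbol \<in> ball 0 1 \<rightarrow> ball 0 1"
proof
  fix z :: complex assume "z \<in> ball 0 1"
  then show "symbol z \<in> ball 0 1"
    using norm_symbol_le[of z] by simp
qed

lemma symbol_not_constant: "\<not> symbol constant_on ball 0 1"
proof
  assume "symbol constant_on ball 0 1"
  then have "symbol (of_real (1/2)) = symbol (of_real 0)"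
    unfolding constant_on_def by (auto simp: norm_divide)
  then have "eval_fps symbol_fps (1/2) = eval_fps symbol_fps 0"
    by (subst (asm) (1 2) symbol_of_real) auto
  moreover have "eval_fps symbol_fps 0 = 0"
    by (simp add: eval_fps_at_0 symbol_fps_0)
  moreover have "fps_nth symbol_fps 1 * (1/2) ^ 1 \<le> eval_fps symbol_fps (1/2)"
    using symbol_fps_sums[of "1/2"] sum_le_suminf[of "\<lambda>k. fps_nth symbol_fps k * (1/2) ^ k" "{1}"]
      symbol_fps_nonneg by (auto simp: sums_iff)
  ultimately show False
    using symbol_fps_1 by simp
qed

text \<open>Replaces the mean value theorem in the proof that the symbol maps a disc about a real point
  to a disc of comparable relative size; the bound does not depend on \<open>k\<close>.\<close>

lemma norm_power_diff_le:
  fixes z :: complex and x l :: real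
  assumes "0 \<le> x" "x \<le> 1" "0 \<le> l" "l \<le> 1" and z: "cmod (z - of_real x) \<le> l * (1 - x)"
  shows "cmod (z ^ k - of_real (x ^ k)) \<le> l * (1 - x ^ k)"
proof (induction k)
  case (Suc k)
  have "cmod z \<le> x + l * (1 - x)"
    using z norm_triangle_ineq[of "z - of_real x" "of_real x"] assms(1) by simp
  also have "\<dots> \<le> x + 1 * (1 - x)"
    using assms by (intro add_left_mono mult_right_mono) auto
  finally have z1: "cmod z \<le> 1" by simp
  have "z ^ Suc k - of_real (x ^ Suc k) = z * (z ^ k - of_real (x ^ k)) + of_real (x ^ k) * (z - of_real x)"
    by (simp add: algebra_simps)
  also have "cmod \<dots> \<le> cmod z * cmod (z ^ k - of_real (x ^ k)) + x ^ k * cmod (z - of_real x)"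
    using norm_triangle_ineq[of "z * (z ^ k - of_real (x ^ k))" "of_real (x ^ k) * (z - of_real x)"] assms(1)
    by (simp add: norm_mult norm_power)
  also have "\<dots> \<le> 1 * (l * (1 - x ^ k)) + x ^ k * (l * (1 - x))"
    using z z1 Suc.IH assms by (intro add_mono mult_mono mult_nonneg_nonneg) (auto simp: power_le_one)
  also have "\<dots> = l * (1 - x ^ Suc k)"
    by (simp add: algebra_simps)
  finally show ?case .
qed simp

text \<open>Each power moves \<open>z\<close> from the real point \<open>x\<close> by at most a
  third of \<open>1 - x ^ k\<close>. Averaging with the nonnegative coefficients preserves the
  relative radius 1 / 3; their sum being at most 1 accounts for the last inequality.\<close>

lemma symbol_near_real:
  assumes t: "0 < t" "t < 1" and z: "cmod (z - of_real (1 - t)) \<le> t / 3"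
  shows "cmod (symbol z - of_real (eval_fps symbol_fps (1 - t))) \<le> (1 - eval_fps symbol_fps (1 - t)) / 3"
proof -
  define x where "x = 1 - t"
  have x: "0 \<le> x" "x \<le> 1" "\<bar>x\<bar> < 1" using t by (auto simp: x_def)
  have z': "cmod (z - of_real x) \<le> t / 3"
    using z by (simp only: x_def)
  have "cmod z \<le> cmod (z - of_real x) + x"
    using norm_triangle_ineq[of "z - of_real x" "of_real x"] x by simp
  then have "cmod z < 1"
    using z' t by (simp add: x_def del: of_real_diff)
  from sums_diff[OF symbol_sums[OF this] sums_of_real[OF symbol_fps_sums[OF x(3)]]]
  have sums: "(\<lambda>k. of_real (fps_nth symbol_fps k) * (z ^ k - of_real (x ^ k))) sums
      (symbol z - of_real (eval_fps symbol_fps x))"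
    by (simp add: right_diff_distrib)
  have sums': "(\<lambda>k. (fps_nth symbol_fps k - fps_nth symbol_fps k * x ^ k) / 3) sums
      ((suminf (fps_nth symbol_fps) - eval_fps symbol_fps x) / 3)"
    by (intro sums_divide sums_diff symbol_fps_sums x summable_sums symbol_fps_summable)
  have "cmod (\<Sum>k. of_real (fps_nth symbol_fps k) * (z ^ k - of_real (x ^ k)))
      \<le> (\<Sum>k. (fps_nth symbol_fps k - fps_nth symbol_fps k * x ^ k) / 3)"
  proof (rule norm_suminf_le)
    fix k
    have "cmod (z ^ k - of_real (x ^ k)) \<le> 1 / 3 * (1 - x ^ k)"
      using z' x by (intro norm_power_diff_le) (auto simp: x_def simp del: of_real_diff)
    from mult_left_mono[OF this symbol_fps_nonneg[of k]]
    have "fps_nth symbol_fps k * cmod (z ^ k - of_real (x ^ k))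
        \<le> (fps_nth symbol_fps k - fps_nth symbol_fps k * x ^ k) / 3"
      by (simp add: right_diff_distrib)
    then show "cmod (of_real (fps_nth symbol_fps k) * (z ^ k - of_real (x ^ k)))
        \<le> (fps_nth symbol_fps k - fps_nth symbol_fps k * x ^ k) / 3"
      by (simp only: norm_mult norm_of_real abs_of_nonneg[OF symbol_fps_nonneg])
  qed (use sums' in \<open>simp add: sums_iff\<close>)
  also have "\<dots> = (suminf (fps_nth symbol_fps) - eval_fps symbol_fps x) / 3"
    using sums' by (simp add: sums_iff)
  also have "\<dots> \<le> (1 - eval_fps symbol_fps x) / 3"
    using symbol_fps_suminf by simp
  finally show ?thesis
    using sums by (simp add: sums_iff x_def)
qed

text \<open>Intermediate values on the interval from \<open>a\<close> to 1. The square bound places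
  the value at \<open>a\<close> below \<open>s\<close>, and at 1 the value is 1. Starting at
  \<open>a > 0\<close> keeps the argument inside the disc of convergence.\<close>

lemma symbol_level_point:
  assumes s: "0 < s" "s < 1"
  obtains t where "0 < t" "t < 1" "1 - eval_fps symbol_fps (1 - t) = s"
proof -
  define a where "a = s\<^sup>2 / 48"
  have a: "0 < a" "a < 1"
    using s power_le_one[of s 2] by (auto simp: a_def)
  have "continuous_on {a..1} (\<lambda>t. 1 - eval_fps symbol_fps (1 - t))"
  proof (intro continuous_intros continuous_on_compose2[OF continuous_on_eval_fps])
    show "(\<lambda>t. 1 - t) ` {a..1} \<subseteq> eball 0 (fps_conv_radius symbol_fps)"
    proof clarify
      fix t assume "t \<in> {a..1}"
      then have "ereal (dist 0 (1 - t)) < 1" using a by (simp add: dist_norm)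
      then show "1 - t \<in> eball 0 (fps_conv_radius symbol_fps)"
        unfolding in_eball_iff using symbol_fps_radius by (rule less_le_trans)
    qed
  qed
  moreover have "1 - eval_fps symbol_fps (1 - a) \<le> s"
  proof -
    have "(1 - eval_fps symbol_fps (1 - a))\<^sup>2 \<le> s\<^sup>2"
      using one_minus_eval_symbol(2)[OF a] by (simp add: a_def)
    then show ?thesis by (rule power2_le_imp_le) (use s in simp)
  qed
  moreover have e1: "1 - eval_fps symbol_fps (1 - 1) = 1"
    by (simp add: eval_fps_at_0 symbol_fps_0)
  ultimately obtain t where t: "a \<le> t" "t \<le> 1" "1 - eval_fps symbol_fps (1 - t) = s"
    using IVT'[of "\<lambda>t. 1 - eval_fps symbol_fps (1 - t)" a s 1] a s by auto
  then have "t \<noteq> 1" using e1 s by auto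
  with t a show ?thesis by (intro that[of t]) auto
qed

lemma approx_num_symbol_lower:
  assumes bdd: "bounded_op bergman bergman_norm (comp_op symbol)" and n: "n > 0"
  shows "1 / 48000 / slow (96 * 10000 ^ n) \<le> approx_num bergman bergman_norm (comp_op symbol) n"
proof -
  have "\<exists>t. 0 < t \<and> t < 1 \<and> 1 - eval_fps symbol_fps (1 - t) = scl j" for j
  proof -
    have "scl j \<le> (1/100) ^ 1"
      unfolding scl_def by (intro power_decreasing) auto
    then have "scl j < 1" by simp
    then show ?thesis using symbol_level_point[OF scl_pos] by metis
  qed
  then obtain t where t: "\<And>j. 0 < t j" "\<And>j. t j < 1"
    and scl: "\<And>j. 1 - eval_fps symbol_fps (1 - t j) = scl j"
    by metis
  \<comment> \<open>The 6 combines the radius \<open>t j / 3\<close> with the factor 2 in the bound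
    of \<open>scl j\<close> by \<open>2 * t j * slow (2 / t j)\<close>.\<close>
  define \<delta> where "\<delta> = 1 / (6 * slow (96 * 10000 ^ n))"
  have slow_pos: "slow (96 * 10000 ^ n) > 0"
    using slow_ge_1[of "96 * 10000 ^ n"] by simp
  have "\<delta> / 8000 \<le> approx_num bergman bergman_norm (comp_op symbol) n"
  proof (rule approx_num_comp_op_lower[OF symbol_holomorphic symbol_maps bdd _ _ _ _ n])
    fix j assume j: "j < n"
    show "ball (of_real (1 - t j)) (t j / 3) \<subseteq> ball (0::complex) 1"
    proof
      fix z :: complex assume "z \<in> ball (of_real (1 - t j)) (t j / 3)"
      then have "cmod (z - of_real (1 - t j)) < t j / 3"
        by (simp add: dist_norm norm_minus_commute del: of_real_diff)
      moreover have "cmod z \<le> cmod (z - of_real (1 - t j)) + (1 - t j)"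
        using norm_triangle_ineq[of "z - of_real (1 - t j)" "of_real (1 - t j)"] t[of j]
        by (simp del: of_real_diff)
      ultimately show "z \<in> ball 0 1"
        using t[of j] by simp
    qed
    show "cmod (symbol z - of_real (1 - scl j)) \<le> scl j / 3"
      if "z \<in> ball (of_real (1 - t j)) (t j / 3)" for z
    proof -
      have "1 - scl j = eval_fps symbol_fps (1 - t j)" using scl[of j] by simp
      then show ?thesis
        using symbol_near_real[OF t[of j], of z] that
        by (simp add: dist_norm norm_minus_commute less_imp_le del: of_real_diff)
    qed
    show "\<delta> * scl j \<le> t j / 3"
    proof -
      \<comment> \<open>The finest scale decides: \<open>scl j\<close> is at least
        \<open>(1/100) ^ n\<close>, so \<open>t j\<close> is at least its square over 48, and one
        value of \<open>slow\<close> serves every \<open>j < n\<close>.\<close>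
      have "(1/100) ^ n \<le> scl j"
        unfolding scl_def using j by (intro power_decreasing) auto
      then have "((1/100) ^ n)\<^sup>2 \<le> (scl j)\<^sup>2"
        by (intro power_mono) auto
      also have "(scl j)\<^sup>2 \<le> 48 * t j"
        using one_minus_eval_symbol(2)[OF t[of j]] by (simp add: scl)
      finally have "(1/100) ^ n * (1/100) ^ n \<le> 48 * t j"
        by (simp only: power2_eq_square)
      then have "1 / 10000 ^ n \<le> 48 * t j"
        by (simp add: power_one_over flip: power_mult_distrib)
      then have "2 / t j \<le> 96 * 10000 ^ n"
        using t(1)[of j] by (simp add: field_simps)
      then have "slow (2 / t j) \<le> slow (96 * 10000 ^ n)"
        using t(1)[of j] by (intro slow_mono) auto
      then have "2 * t j * slow (2 / t j) \<le> 2 * t j * slow (96 * 10000 ^ n)"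
        using t(1)[of j] by (intro mult_left_mono) auto
      then have "scl j \<le> 2 * t j * slow (96 * 10000 ^ n)"
        using one_minus_eval_symbol(1)[OF t[of j]] by (simp add: scl)
      then show ?thesis
        using slow_pos by (simp add: \<delta>_def field_simps)
    qed
  qed (use slow_pos in \<open>simp add: \<delta>_def\<close>)
  then show ?thesis by (simp add: \<delta>_def)
qed

text \<open>Along a geometric progression \<open>slow\<close> grows like ln n, and every power of ln
  n is eventually below n, so the harmonic series is a minorant.\<close>

lemma slow_powr_not_summable:
  assumes "p > 0"
  shows "\<not> summable (\<lambda>n. (1 / 48000 / slow (96 * 10000 ^ Suc n)) powr p)"
proof
  assume *: "summable (\<lambda>n. (1 / 48000 / slow (96 * 10000 ^ Suc n)) powr p)"
  have "\<forall>\<^sub>F n in sequentially. 1 / real n \<le> (1 / 48000 / slow (96 * 10000 ^ Suc n)) powr p"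
    unfolding slow_def power_Suc using assms by real_asymp
  then have "\<forall>\<^sub>F n in sequentially. norm (1 / real n) \<le> (1 / 48000 / slow (96 * 10000 ^ Suc n)) powr p"
    by eventually_elim simp
  then have "summable (\<lambda>n. 1 / real n)"
    using * by (rule summable_comparison_test_ev)
  then show False
    using not_summable_harmonic[where 'a = real] by (simp add: inverse_eq_divide)
qed

theorem theorem4p3:
  shows "\<exists>\<phi>. \<phi> holomorphic_on ball 0 1 \<and> \<phi> \<in> ball 0 1 \<rightarrow> ball 0 1 \<and> \<not> \<phi> constant_on ball 0 1 \<and>
           compact_op hardy hardy_norm (comp_op \<phi>) \<and>
           (\<forall>p>0. comp_op \<phi> \<notin> schatten p bergman bergman_norm)"
proof (intro exI conjI allI impI)
  show "compact_op hardy hardy_norm (comp_op symbol)"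
    by (rule compact_comp_op_hardy[OF symbol_fps_0 symbol_fps_nonneg symbol_fps_sum_le_1 _ _
          symbol_holomorphic symbol_maps symbol_has_fps_expansion])
      (simp_all add: inverse_one_minus_symbol slow_fps_decseq slow_fps_tendsto_0)
  fix p :: real assume p: "p > 0"
  show "comp_op symbol \<notin> schatten p bergman bergman_norm"
  proof
    assume "comp_op symbol \<in> schatten p bergman bergman_norm"
    \<comment> \<open>Membership in the class, assumed for contradiction, itself provides the
      boundedness on the Bergman space that the lower bound requires.\<close>
    then have bdd: "bounded_op bergman bergman_norm (comp_op symbol)"
      and sum: "summable (\<lambda>n. approx_num bergman bergman_norm (comp_op symbol) (Suc n) powr p)"
      by (auto simp: schatten_def compact_op_def)
    have "summable (\<lambda>n. (1 / 48000 / slow (96 * 10000 ^ Suc n)) powr p)"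
    proof (rule summable_comparison_test'[OF sum])
      fix n :: nat
      have "1 / 48000 / slow (96 * 10000 ^ Suc n) \<ge> 0"
        using slow_ge_1[of "96 * 10000 ^ Suc n"] by simp
      then show "norm ((1 / 48000 / slow (96 * 10000 ^ Suc n)) powr p)
          \<le> approx_num bergman bergman_norm (comp_op symbol) (Suc n) powr p"
        using approx_num_symbol_lower[OF bdd, of "Suc n"] p by (simp add: powr_mono2)
    qed
    then show False
      using slow_powr_not_summable[OF p] by blast
  qed
qed (fact symbol_holomorphic symbol_maps symbol_not_constant)+

end
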